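(* Let $\Omega=(x_i,x_f)\subseteq\mathbb R$ be an open interval (bounded or unbounded) and let $f,h$ be probability density functions, both with support $\overline\Omega$, with $f(x)>0$ and $h(x)>0$ for all $x\in\Omega$. Let $p\in\mathbb R$ with Hölder conjugate $p^*$, and let $\alpha>0$. (i) If $p^*>0$, then $$\sigma_{p^*,\alpha}[f\|h]\;e^{D[f\|h]}\ \ge\ \big(K^{(0)}_{p,1}\big)^{1/\alpha}.$$ (ii) If $p>1$, $f$ and $h$ are differentiable on $\Omega$, and the relative differential-escort density $\mathfrak R_\alpha^{[h]}[f]$ (equal to $0$ outside its support) is absolutely continuous on $\mathbb R$, then $$e^{-D[f\|h]}\;\phi_{p,\alpha}[f\|h]\ \ge\ \Big(\frac{K^{(1)}_{p,1}}{\alpha}\Big)^{1/\alpha}.$$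
   Context: Kullback-Leibler divergence: $D[f\|h]=\int_\Omega f\log\frac fh\,dx$. Relative differential-escort transformation: $\mathfrak R_\alpha^{[h]}[f](y)=\big(f(x(y))/h(x(y))\big)^\alpha$, where $y'(x)=f(x)^{1-\alpha}h(x)^\alpha$ and $x(y)$ is the inverse function of $y(x)$. It is a probability density in $y$, defined up to a translation (an integration constant); the canonical choice is $y(x)=\int_{x_i}^xf^{1-\alpha}h^\alpha\,dt$. Relative cumulative moment: for $q>0$, $\mu_{q,\alpha}[f\|h]$ is the $q$-th absolute moment $\int|y|^q\,\mathfrak R_\alpha^{[h]}[f](y)\,dy$, explicitly $$\mu_{q,\alpha}[f\|h]=\int_\Omega\Big|\int_{x_i}^xf(s)^{1-\alpha}h(s)^\alpha\,ds\Big|^qf(x)\,dx,\qquad \sigma_{q,\alpha}[f\|h]=\mu_{q,\alpha}[f\|h]^{1/(q\alpha)}.$$ Relative Fisher divergence: for $p>1$, $\lambda\ne0$, $\phi_{p,\lambda}[f\|h]=\Big(\int_\Omega f^{1+p(\lambda-1)}h^{-\lambda p}\big|\frac d{dx}\log\frac fh\big|^pdx\Big)^{1/(p\lambda)}$. Constants: let $g_{p,1}(x)=a_{p,1}e^{-|x|^{p^*}}$ with $a_{p,1}$ the normalization constant. For a density $g$, put $\sigma_q[g]=(\int|x|^qg\,dx)^{1/q}$, $N[g]=\exp(-\int g\log g\,dx)$, and $\phi_{p,1}[g]=\big(\int |g'/g|^p g\,dx\big)^{1/p}$. Then $K^{(0)}_{p,1}=\sigma_{p^*}[g_{p,1}]/N[g_{p,1}]$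 and $K^{(1)}_{p,1}=\phi_{p,1}[g_{p,1}]\,N[g_{p,1}]$. *)

theory Defs
  imports "HOL-Analysis.Analysis"
begin

section \<open>Extended nonnegative arithmetic\<close>

text \<open>Divergences and moments may be infinite, so the inequalities are stated in
  \<^typ>\<open>ennreal\<close>.  In \<open>epowr\<close>, \<open>0\<close> to a negative power is \<open>\<infinity>\<close> (unlike \<^const>\<open>powr\<close>).\<close>

definition epowr :: "ennreal \<Rightarrow> real \<Rightarrow> ennreal" where
  "epowr x a =
     (if a = 0 then 1
      else if x = 0 then (if a > 0 then 0 else \<infinity>)
      else if x = \<infinity> then (if a > 0 then \<infinity> else 0)
      else ennreal (enn2real x powr a))"

definition exp_ereal :: "ereal \<Rightarrow> ennreal" where
  "exp_ereal x =
     (if x = \<infinity> then \<infinity> else if x = -\<infinity> then 0 else ennreal (exp (real_of_ereal x)))"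

section \<open>Densities\<close>

definition is_pdf :: "(real \<Rightarrow> real) \<Rightarrow> bool" where
  "is_pdf f \<longleftrightarrow> f \<in> borel_measurable borel \<and> (\<forall>x. 0 \<le> f x) \<and>
     (\<integral>\<^sup>+x. ennreal (f x) \<partial>lborel) = 1"

definition fun_support :: "(real \<Rightarrow> real) \<Rightarrow> real set" where
  "fun_support f = closure {x. f x \<noteq> 0}"

text \<open>The classical epsilon-delta notion for functions, on all of the real line at once; the
  library's \<^const>\<open>absolutely_continuous\<close> concerns measures.\<close>

definition abs_continuous_real :: "(real \<Rightarrow> real) \<Rightarrow> bool" where
  "abs_continuous_real g \<longleftrightarrow>
     (\<forall>\<epsilon>>0. \<exists>\<delta>>0. \<forall>(n::nat) a b.
        (\<forall>i<n. a i \<le> b i) \<and> disjoint_family_on (\<lambda>i. {a i<..<b i}) {..<n} \<and>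
        (\<Sum>i<n. b i - a i) < \<delta>
        \<longrightarrow> (\<Sum>i<n. \<bar>g (b i) - g (a i)\<bar>) < \<epsilon>)"

section \<open>Relative functionals on an interval with end points \<open>xi\<close> and \<open>xf\<close>\<close>

text \<open>Extended-real value of the integral of \<open>f log (f/h)\<close>.  For densities the negative part is
  dominated by \<open>h\<close>, hence has a finite integral, and the difference is never \<open>\<infinity> - \<infinity>\<close>.\<close>

definition KL_div :: "ereal \<Rightarrow> ereal \<Rightarrow> (real \<Rightarrow> real) \<Rightarrow> (real \<Rightarrow> real) \<Rightarrow> ereal" where
  "KL_div xi xf f h =
     enn2ereal (\<integral>\<^sup>+x\<in>einterval xi xf. ennreal (f x * ln (f x / h x)) \<partial>lborel)
     - enn2ereal (\<integral>\<^sup>+x\<in>einterval xi xf. ennreal (- (f x * ln (f x / h x))) \<partial>lborel)"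

text \<open>\<open>y\<close> is an antiderivative on \<open>(xi, xf)\<close> of the density that defines the new variable; the
  integration constant is left free.  Outside its range the transformed density is \<open>0\<close>.\<close>

definition escort_variable ::
  "real \<Rightarrow> ereal \<Rightarrow> ereal \<Rightarrow> (real \<Rightarrow> real) \<Rightarrow> (real \<Rightarrow> real) \<Rightarrow> (real \<Rightarrow> real) \<Rightarrow> bool" where
  "escort_variable \<alpha> xi xf f h y \<longleftrightarrow>
     (\<forall>x\<in>einterval xi xf. (y has_real_derivative f x powr (1 - \<alpha>) * h x powr \<alpha>) (at x))"

definition rel_escort ::
  "real \<Rightarrow> ereal \<Rightarrow> ereal \<Rightarrow> (real \<Rightarrow> real) \<Rightarrow> (real \<Rightarrow> real) \<Rightarrow> (real \<Rightarrow> real) \<Rightarrow> real \<Rightarrow> real" where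
  "rel_escort \<alpha> xi xf f h y u =
     (if u \<in> y ` einterval xi xf
      then (let x = inv_into (einterval xi xf) y u in (f x / h x) powr \<alpha>)
      else 0)"

text \<open>The inner integral is nonnegative, so no absolute value is needed.  It may be \<open>\<infinity>\<close> when
  \<open>\<alpha> > 1\<close>, and the moment is then \<open>\<infinity>\<close>.\<close>

definition rel_moment ::
  "real \<Rightarrow> real \<Rightarrow> ereal \<Rightarrow> ereal \<Rightarrow> (real \<Rightarrow> real) \<Rightarrow> (real \<Rightarrow> real) \<Rightarrow> ennreal" where
  "rel_moment q \<alpha> xi xf f h =
     (\<integral>\<^sup>+x\<in>einterval xi xf.
        epowr (\<integral>\<^sup>+s\<in>einterval xi (ereal x).
                 ennreal (f s powr (1 - \<alpha>) * h s powr \<alpha>) \<partial>lborel) q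
        * ennreal (f x) \<partial>lborel)"

definition rel_sigma ::
  "real \<Rightarrow> real \<Rightarrow> ereal \<Rightarrow> ereal \<Rightarrow> (real \<Rightarrow> real) \<Rightarrow> (real \<Rightarrow> real) \<Rightarrow> ennreal" where
  "rel_sigma q \<alpha> xi xf f h = epowr (rel_moment q \<alpha> xi xf f h) (1 / (q * \<alpha>))"

definition rel_fisher ::
  "real \<Rightarrow> real \<Rightarrow> ereal \<Rightarrow> ereal \<Rightarrow> (real \<Rightarrow> real) \<Rightarrow> (real \<Rightarrow> real) \<Rightarrow> ennreal" where
  "rel_fisher p l xi xf f h =
     epowr (\<integral>\<^sup>+x\<in>einterval xi xf.
              ennreal (f x powr (1 + p * (l - 1)) * h x powr (- l * p)
                       * \<bar>deriv (\<lambda>t. ln (f t / h t)) x\<bar> powr p) \<partial>lborel)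
           (1 / (p * l))"

section \<open>The optimal constants\<close>

text \<open>Real-valued Lebesgue integrals suffice here: the functionals are only evaluated at
  \<open>gen_gauss p\<close> with \<open>holder_conj p > 0\<close>, and for \<open>fisher_dev\<close> with \<open>p > 1\<close>, where they all
  converge.  \<open>holder_conj 1\<close> is \<open>0\<close> by division by zero.\<close>

definition holder_conj :: "real \<Rightarrow> real" where
  "holder_conj p = p / (p - 1)"

definition gen_gauss :: "real \<Rightarrow> real \<Rightarrow> real" where
  "gen_gauss p x =
     exp (- (\<bar>x\<bar> powr holder_conj p)) / (\<integral>t. exp (- (\<bar>t\<bar> powr holder_conj p)) \<partial>lborel)"

definition moment_dev :: "real \<Rightarrow> (real \<Rightarrow> real) \<Rightarrow> real" where
  "moment_dev q g = (\<integral>x. \<bar>x\<bar> powr q * g x \<partial>lborel) powr (1 / q)"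

definition entropy_power :: "(real \<Rightarrow> real) \<Rightarrow> real" where
  "entropy_power g = exp (- (\<integral>x. g x * ln (g x) \<partial>lborel))"

definition fisher_dev :: "real \<Rightarrow> (real \<Rightarrow> real) \<Rightarrow> real" where
  "fisher_dev p g = (\<integral>x. \<bar>deriv g x / g x\<bar> powr p * g x \<partial>lborel) powr (1 / p)"

definition K0 :: "real \<Rightarrow> real" where
  "K0 p = moment_dev (holder_conj p) (gen_gauss p) / entropy_power (gen_gauss p)"

definition K1 :: "real \<Rightarrow> real" where
  "K1 p = fisher_dev p (gen_gauss p) * entropy_power (gen_gauss p)"

end

theory Submission
  imports Defs "HOL-Probability.Distribution_Functions"
begin

text \<open>In the escort variable \<open>y\<close> the two claims are the sharp moment-entropy and Fisher-entropy
  inequalities for the density \<open>\<rho> = (f/h)^\<alpha>\<close>, whose entropy is \<open>- \<alpha> D\<close>; both are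
  proved in the original variable \<open>x\<close>. Put \<open>k = f^(1-\<alpha>) h^\<alpha> = dy/dx\<close> and \<open>q = p*\<close>.

  (i) Gibbs' inequality compares \<open>f\<close> with \<open>c exp (- t Y^q) k\<close>, where \<open>Y\<close> is the integral of \<open>k\<close> from
  the left end point. Its mass is at most the mass of \<open>c exp (- t v^q)\<close> on the half line, because
  the measure with density \<open>k\<close> gives mass at most \<open>u\<close> to \<open>{Y \<le> u}\<close>. Then optimize over \<open>t\<close>.

  (ii) Let \<open>T\<close> transport \<open>f dx\<close> to the generalized Gaussian \<open>g\<close>, that is, \<open>f = g(T) T'\<close>. With
  \<open>V = (f/h)^\<alpha>\<close>, the bound \<open>ln (T' V / f) \<le> s T' V / f - 1 - ln s\<close> turns \<open>\<integral> f ln V\<close> into the entropy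
  of \<open>g\<close> plus \<open>\<integral> T' V\<close>, which is at most \<open>\<integral> |T| |V'|\<close> by parts and is then estimated by
  the Hoelder inequality. Absolute continuity of \<open>\<rho>\<close> on the whole line makes \<open>V\<close> bounded and forces it
  to take arbitrarily small values near both ends of \<open>\<Omega>\<close>, which removes the boundary terms.\<close>

section \<open>Integration on the line and the generalized Gaussian\<close>

lemma nn_integral_UN_incseq:
  assumes "incseq A" "\<And>i. A i \<in> sets M" and [measurable]: "f \<in> borel_measurable M"
  shows "(\<integral>\<^sup>+x\<in>(\<Union>i. A i). f x \<partial>M) = (SUP i. \<integral>\<^sup>+x\<in>A i. f x \<partial>M)"
proof -
  have [measurable]: "\<And>i. A i \<in> sets M" using assms by auto
  have "(SUP i. emeasure (density M f) (A i)) = emeasure (density M f) (\<Union>i. A i)"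
    using assms by (intro SUP_emeasure_incseq) auto
  then show ?thesis by (simp add: emeasure_density)
qed

text \<open>The open interval is exhausted by compact ones, where the classical substitution rule
  applies, and both sides pass to the limit by monotonicity. Writing the right-hand side over the
  image of \<open>T\<close> covers finite and infinite end points alike.\<close>

lemma nn_integral_substitution_einterval:
  fixes T T' \<phi> :: "real \<Rightarrow> real"
  assumes ab: "a < b"
    and T: "\<And>x. x \<in> einterval a b \<Longrightarrow> (T has_real_derivative T' x) (at x)"
    and cont: "continuous_on (einterval a b) T'"
    and nonneg: "\<And>x. x \<in> einterval a b \<Longrightarrow> 0 \<le> T' x"
    and \<phi>[measurable]: "\<phi> \<in> borel_measurable borel"
  shows "(\<integral>\<^sup>+x\<in>einterval a b. ennreal (\<phi> (T x) * T' x) \<partial>lborel)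
         = (\<integral>\<^sup>+x\<in>T ` einterval a b. ennreal (\<phi> x) \<partial>lborel)"
proof -
  obtain u l :: "nat \<Rightarrow> real" where ul: "einterval a b = (\<Union>i. {l i .. u i})"
    "incseq u" "decseq l" "\<And>i. l i < u i"
    by (rule einterval_Icc_approximation[OF ab], rule that)
  have sub: "{l i..u i} \<subseteq> einterval a b" for i using ul(1) by auto
  have inc: "incseq (\<lambda>i. {l i..u i})"
  proof (rule incseq_SucI)
    show "{l i..u i} \<subseteq> {l (Suc i)..u (Suc i)}" for i
      using incseq_SucD[OF ul(2), of i] decseq_SucD[OF ul(3), of i] by auto
  qed
  have contT: "continuous_on (einterval a b) T"
    using T by (meson DERIV_continuous_on has_field_derivative_at_within)
  have mono: "T x \<le> T y" if "x \<le> y" "x \<in> einterval a b" "y \<in> einterval a b" for x y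
  proof (rule DERIV_nonneg_imp_nondecreasing[OF that(1)])
    fix z assume "x \<le> z" "z \<le> y"
    then have "z \<in> einterval a b"
      using that less_le_trans[of a "ereal x" "ereal z"] le_less_trans[of "ereal z" "ereal y" b]
      by (simp add: einterval_iff)
    then show "\<exists>w. (T has_real_derivative w) (at z) \<and> 0 \<le> w" using T nonneg by blast
  qed
  have img: "T ` {l i..u i} = {T (l i)..T (u i)}" for i
  proof
    have mem: "l i \<in> einterval a b" "u i \<in> einterval a b" using sub[of i] ul(4)[of i] by auto
    show "T ` {l i..u i} \<subseteq> {T (l i)..T (u i)}" 
    proof safe
      fix x assume "x \<in> {l i..u i}"
      then show "T x \<in> {T (l i)..T (u i)}" using mono[of "l i" x] mono[of x "u i"] mem sub[of i] by auto
    qed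
    show "{T (l i)..T (u i)} \<subseteq> T ` {l i..u i}"
    proof
      fix v assume "v \<in> {T (l i)..T (u i)}"
      then show "v \<in> T ` {l i..u i}"
        using IVT'[of T "l i" v "u i"] ul(4)[of i] continuous_on_subset[OF contT sub[of i]] by auto
    qed
  qed
  define A where "A = einterval a b"
  have [measurable]: "A \<in> sets borel" by (simp add: A_def)
  have [measurable]: "(\<lambda>x. indicator A x * T x) \<in> borel_measurable borel"
    "(\<lambda>x. indicator A x * T' x) \<in> borel_measurable borel"
    using borel_measurable_continuous_on_indicator[of A T] borel_measurable_continuous_on_indicator[of A T']
      contT cont by (auto simp: A_def)
  \<comment> \<open>Measurability of \<open>T\<close> and \<open>T'\<close> is known only on the
    interval; cutting them off by indicators gives a globally measurable integrand with the same
    values there.\<close>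
  define H where "H x = ennreal (\<phi> (indicator A x * T x) * (indicator A x * T' x))" for x
  have [measurable]: "H \<in> borel_measurable borel" unfolding H_def by measurable
  have "(\<integral>\<^sup>+x\<in>einterval a b. ennreal (\<phi> (T x) * T' x) \<partial>lborel) = (\<integral>\<^sup>+x\<in>einterval a b. H x \<partial>lborel)"
    by (intro nn_integral_cong) (simp add: H_def A_def indicator_def)
  also have "\<dots> = (SUP i. \<integral>\<^sup>+x\<in>{l i..u i}. H x \<partial>lborel)"
    unfolding ul(1) using inc by (intro nn_integral_UN_incseq) auto
  also have "\<dots> = (SUP i. \<integral>\<^sup>+x\<in>T ` {l i..u i}. ennreal (\<phi> x) \<partial>lborel)"
  proof (rule SUP_cong[OF refl])
    fix i
    have "(\<integral>\<^sup>+x\<in>{l i..u i}. H x \<partial>lborel) = (\<integral>\<^sup>+x. \<phi> (T x) * T' x * indicator {l i..u i} x \<partial>lborel)"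
      using sub[of i] by (intro nn_integral_cong) (auto simp: H_def A_def indicator_def)
    also have "\<dots> = (\<integral>\<^sup>+x. \<phi> x * indicator {T (l i)..T (u i)} x \<partial>lborel)"
      using ul(4)[of i] sub[of i]
      by (intro nn_integral_substitution[symmetric])
        (auto intro!: T nonneg continuous_on_subset[OF cont] simp: set_borel_measurable_def)
    also have "\<dots> = (\<integral>\<^sup>+x\<in>T ` {l i..u i}. ennreal (\<phi> x) \<partial>lborel)"
      unfolding img by (intro nn_integral_cong) (auto simp: indicator_def)
    finally show "(\<integral>\<^sup>+x\<in>{l i..u i}. H x \<partial>lborel) = (\<integral>\<^sup>+x\<in>T ` {l i..u i}. ennreal (\<phi> x) \<partial>lborel)" .
  qed
  also have "\<dots> = (\<integral>\<^sup>+x\<in>(\<Union>i. T ` {l i..u i}). ennreal (\<phi> x) \<partial>lborel)"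
    using inc by (intro nn_integral_UN_incseq[symmetric]) (auto simp: incseq_def image_mono simp flip: img, simp add: img)
  also have "(\<Union>i. T ` {l i..u i}) = T ` einterval a b" unfolding ul(1) by auto
  finally show ?thesis .
qed

lemma nn_integral_even:
  fixes \<phi> :: "real \<Rightarrow> ennreal"
  assumes [measurable]: "\<phi> \<in> borel_measurable borel"
  shows "(\<integral>\<^sup>+x. \<phi> \<bar>x\<bar> \<partial>lborel) = 2 * (\<integral>\<^sup>+x\<in>{0<..}. \<phi> x \<partial>lborel)"
proof -
  have "(\<integral>\<^sup>+x. \<phi> \<bar>x\<bar> \<partial>lborel)
      = (\<integral>\<^sup>+x. \<phi> x * indicator {0<..} x + \<phi> (- x) * indicator {0<..} (- x) \<partial>lborel)"
    using AE_lborel_singleton[of "0::real"] by (intro nn_integral_cong_AE, eventually_elim) (auto simp: indicator_def)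
  also have "\<dots> = (\<integral>\<^sup>+x\<in>{0<..}. \<phi> x \<partial>lborel) + (\<integral>\<^sup>+x. \<phi> (- x) * indicator {0<..} (- x) \<partial>lborel)"
    by (intro nn_integral_add) auto
  also have "(\<integral>\<^sup>+x. \<phi> (- x) * indicator {0<..} (- x) \<partial>lborel) = (\<integral>\<^sup>+x\<in>{0<..}. \<phi> x \<partial>lborel)"
    using nn_integral_real_affine[of "\<lambda>x. \<phi> x * indicator {0<..} x" "-1" 0] by simp
  finally show ?thesis by (simp add: mult_2)
qed

text \<open>The substitution \<open>s = x^q\<close> on the half line produces Euler's integral for
  \<open>Gamma\<close> at \<open>(r + 1) / q\<close>; evenness doubles it.\<close>

lemma nn_integral_powr_mult_exp_powr:
  fixes q r :: real
  assumes q: "q > 0" and r: "r \<ge> 0"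
  shows "(\<integral>\<^sup>+x. ennreal (\<bar>x\<bar> powr r * exp (- (\<bar>x\<bar> powr q))) \<partial>lborel)
         = ennreal (2 * Gamma ((r + 1) / q) / q)"
proof -
  let ?z = "(r + 1) / q"
  have z: "?z > 0" using assms by simp
  \<comment> \<open>The factor \<open>1 / q\<close> cancels the one from the derivative of
    \<open>x powr q\<close>, and the exponents combine to
    \<open>q (?z - 1) + (q - 1) = r\<close>.\<close>
  define \<phi> where "\<phi> s = s powr (?z - 1) / exp s / q" for s
  have [measurable]: "\<phi> \<in> borel_measurable borel" unfolding \<phi>_def by measurable
  have sub: "(\<integral>\<^sup>+x\<in>einterval 0 \<infinity>. ennreal (\<phi> (x powr q) * (q * x powr (q - 1))) \<partial>lborel)
         = (\<integral>\<^sup>+x\<in>(\<lambda>x. x powr q) ` einterval 0 \<infinity>. ennreal (\<phi> x) \<partial>lborel)"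
    using q
    by (intro nn_integral_substitution_einterval)
      (auto simp: einterval_iff intro!: derivative_eq_intros continuous_on_mult_left continuous_on_powr)
  have ei: "einterval 0 \<infinity> = {0<..}" by (simp add: zero_ereal_def)
  have img: "(\<lambda>x. x powr q) ` {0<..} = {0<..}"
  proof -
    have "x = (x powr (1/q)) powr q" if "x > 0" for x using that q by (simp add: powr_powr)
    then show ?thesis by (auto simp: image_iff) (metis greaterThan_iff powr_gt_zero less_irrefl)
  qed
  have "(\<integral>\<^sup>+x\<in>{0<..}. ennreal (x powr r * exp (- (x powr q))) \<partial>lborel)
      = (\<integral>\<^sup>+x\<in>{0<..}. ennreal (\<phi> (x powr q) * (q * x powr (q - 1))) \<partial>lborel)"
  proof (intro nn_integral_cong)
    fix x :: real
    have "\<phi> (x powr q) * (q * x powr (q - 1)) = x powr r * exp (- (x powr q))" if "x > 0"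
    proof -
      have "(x powr q) powr (?z - 1) * x powr (q - 1) = x powr r"
        using q that by (simp add: powr_powr field_simps flip: powr_add)
      then show ?thesis using q by (simp add: \<phi>_def exp_minus field_simps)
    qed
    then show "ennreal (x powr r * exp (- (x powr q))) * indicator {0<..} x
      = ennreal (\<phi> (x powr q) * (q * x powr (q - 1))) * indicator {0<..} x"
      by (auto simp: indicator_def)
  qed
  also have "\<dots> = (\<integral>\<^sup>+x\<in>{0<..}. ennreal (\<phi> x) \<partial>lborel)" using sub by (simp add: ei img)
  also have "\<dots> = (\<integral>\<^sup>+x\<in>{0..}. ennreal (\<phi> x) \<partial>lborel)"
    using AE_lborel_singleton[of "0::real"] by (intro nn_integral_cong_AE, eventually_elim) (auto simp: indicator_def)
  also have "\<dots> = ennreal (Gamma ?z / q)"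
  proof (rule nn_integral_has_integral_lebesgue')
    show "0 \<le> \<phi> x" for x using q by (simp add: \<phi>_def)
    show "(\<phi> has_integral Gamma ?z / q) {0..}"
      unfolding \<phi>_def using Gamma_integral_real[OF z] by (rule has_integral_divide)
  qed
  finally have *: "(\<integral>\<^sup>+x\<in>{0<..}. ennreal (x powr r * exp (- (x powr q))) \<partial>lborel) = ennreal (Gamma ?z / q)" .
  have "(\<integral>\<^sup>+x. ennreal (\<bar>x\<bar> powr r * exp (- (\<bar>x\<bar> powr q))) \<partial>lborel)
      = 2 * (\<integral>\<^sup>+x\<in>{0<..}. ennreal (x powr r * exp (- (x powr q))) \<partial>lborel)"
    by (rule nn_integral_even) measurable
  also have "\<dots> = ennreal (2 * Gamma ?z / q)"
    unfolding * using q z Gamma_real_pos[OF z] by (simp flip: ennreal_mult'' ennreal_numeral)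
  finally show ?thesis .
qed

section \<open>Normalization, moment, entropy power and Fisher information of the generalized
  Gaussian\<close>

definition gg_const :: "real \<Rightarrow> real" where
  "gg_const q = (\<integral>t. exp (- (\<bar>t\<bar> powr q)) \<partial>lborel)"

text \<open>Both integrals are values of \<open>Gamma\<close>, at \<open>1 / q\<close> and at
  \<open>1 / q + 1\<close>. The functional equation makes their ratio \<open>1 / q\<close>, which is
  thus the \<open>q\<close>-th moment of the normalized density.\<close>

lemma
  fixes q :: real
  assumes q: "q > 0"
  shows gg_integrable: "integrable lborel (\<lambda>x. exp (- (\<bar>x\<bar> powr q)))"
    and gg_const_pos: "gg_const q > 0"
    and gg_moment_integrable: "integrable lborel (\<lambda>x. \<bar>x\<bar> powr q * exp (- (\<bar>x\<bar> powr q)))"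
    and gg_moment: "(\<integral>x. \<bar>x\<bar> powr q * exp (- (\<bar>x\<bar> powr q)) \<partial>lborel) = gg_const q / q"
proof -
  \<comment> \<open>Since \<open>0 powr 0 = 0\<close>, the case \<open>r = 0\<close> of the formula
    matches this integrand only away from the origin.\<close>
  have n0: "(\<integral>\<^sup>+x. ennreal (exp (- (\<bar>x\<bar> powr q))) \<partial>lborel) = ennreal (2 * Gamma (1 / q) / q)"
  proof -
    have "(\<integral>\<^sup>+x. ennreal (exp (- (\<bar>x\<bar> powr q))) \<partial>lborel)
      = (\<integral>\<^sup>+x. ennreal (\<bar>x\<bar> powr 0 * exp (- (\<bar>x\<bar> powr q))) \<partial>lborel)"
      using AE_lborel_singleton[of "0::real"] by (intro nn_integral_cong_AE, eventually_elim) auto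
    then show ?thesis using nn_integral_powr_mult_exp_powr[OF q, of 0] by simp
  qed
  have n1: "(\<integral>\<^sup>+x. ennreal (\<bar>x\<bar> powr q * exp (- (\<bar>x\<bar> powr q))) \<partial>lborel) = ennreal (2 * Gamma ((q + 1) / q) / q)"
    using nn_integral_powr_mult_exp_powr[OF q, of q] q by simp
  have G0: "Gamma (1 / q) > 0" using q by (intro Gamma_real_pos) auto
  have G1: "Gamma ((q + 1) / q) = Gamma (1 / q) / q"
  proof -
    have "1 / q \<notin> \<int>\<^sub>\<le>\<^sub>0" using q by (auto elim!: nonpos_Ints_cases) (smt (verit) divide_pos_pos of_int_le_0_iff)
    then show ?thesis using Gamma_plus1[of "1 / q"] q by (simp add: add_divide_distrib add.commute)
  qed
  have c: "gg_const q = 2 * Gamma (1 / q) / q"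
    unfolding gg_const_def using n0 G0 q by (subst integral_eq_nn_integral) auto
  show "gg_const q > 0" using c G0 q by simp
  show "integrable lborel (\<lambda>x. exp (- (\<bar>x\<bar> powr q)))"
    using n0 by (intro integrableI_nonneg) auto
  show "integrable lborel (\<lambda>x. \<bar>x\<bar> powr q * exp (- (\<bar>x\<bar> powr q)))"
    using n1 by (intro integrableI_nonneg) auto
  show "(\<integral>x. \<bar>x\<bar> powr q * exp (- (\<bar>x\<bar> powr q)) \<partial>lborel) = gg_const q / q"
    using n1 G0 G1 c q by (subst integral_eq_nn_integral) auto
qed

lemma gen_gauss_eq: "gen_gauss p x = exp (- (\<bar>x\<bar> powr holder_conj p)) / gg_const (holder_conj p)"
  by (simp add: gen_gauss_def gg_const_def)

text \<open>The common value of \<open>1 / K0\<close> and \<open>K1\<close>.\<close>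

definition gg_bound :: "real \<Rightarrow> real" where
  "gg_bound q = (q * exp 1) powr (1 / q) * gg_const q"

lemma gg_bound_pos: "q > 0 \<Longrightarrow> gg_bound q > 0"
  using gg_const_pos[of q] by (simp add: gg_bound_def)

text \<open>Here \<open>- ln g = |x|^q + ln Z\<close>, so the entropy is the moment
  \<open>1 / q\<close> plus \<open>ln Z\<close>.\<close>

lemma entropy_power_gen_gauss:
  assumes q: "holder_conj p = q" "q > 0"
  shows "entropy_power (gen_gauss p) = exp (1 / q) * gg_const q"
proof -
  let ?Z = "gg_const q"
  have Z: "?Z > 0" using gg_const_pos q by simp
  have "gen_gauss p x * ln (gen_gauss p x)
     = - (\<bar>x\<bar> powr q * exp (- (\<bar>x\<bar> powr q))) / ?Z - ln ?Z / ?Z * exp (- (\<bar>x\<bar> powr q))" for x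
    using Z by (simp add: gen_gauss_eq q ln_div field_simps)
  then have "(\<integral>x. gen_gauss p x * ln (gen_gauss p x) \<partial>lborel) = - (?Z / q) / ?Z - ln ?Z / ?Z * ?Z"
    using gg_integrable[OF q(2)] gg_moment_integrable[OF q(2)] gg_moment[OF q(2)]
    by (simp add: gg_const_def)
  also have "\<dots> = - (1 / q) - ln ?Z" using Z q by (simp add: field_simps)
  finally show ?thesis using Z by (simp add: entropy_power_def exp_add)
qed

lemma moment_gen_gauss:
  assumes q: "holder_conj p = q" "q > 0"
  shows "(\<integral>x. \<bar>x\<bar> powr q * gen_gauss p x \<partial>lborel) = 1 / q"
  using gg_moment[OF q(2)] gg_const_pos[OF q(2)] by (simp add: gen_gauss_eq q)

lemma K0_eq:
  assumes q: "holder_conj p = q" "q > 0"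
  shows "K0 p = 1 / gg_bound q"
proof -
  have "moment_dev q (gen_gauss p) = (1 / q) powr (1 / q)"
    by (simp only: moment_dev_def moment_gen_gauss[OF q])
  then show ?thesis
    using gg_const_pos[OF q(2)] q entropy_power_gen_gauss[OF q]
    by (simp add: K0_def gg_bound_def powr_divide powr_mult powr_def[of "exp 1"] field_simps)
qed

text \<open>For \<open>q \<le> 1\<close> the density is not differentiable at the origin, which is
  therefore excluded; the Fisher integral ignores one point.\<close>

lemma gen_gauss_log_deriv:
  assumes q: "holder_conj p = q" "q > 0" and x: "x \<noteq> 0"
  shows "deriv (gen_gauss p) x / gen_gauss p x = - (q * \<bar>x\<bar> powr (q - 1) * sgn x)"
proof -
  have Z: "gg_const q > 0" using gg_const_pos q by simp
  have 1: "((\<lambda>x. \<bar>x\<bar> powr q) has_real_derivative q * \<bar>x\<bar> powr (q - 1) * sgn x) (at x)"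
  proof -
    have *: "(abs has_real_derivative sgn x) (at x)"
    proof (cases "x > 0")
      case True
      then show ?thesis
        using has_field_derivative_transform_within_open[OF DERIV_ident, of "{0<..}" x abs] by auto
    next
      case False
      then show ?thesis
        using x has_field_derivative_transform_within_open[OF DERIV_minus[OF DERIV_ident], of "{..<0}" x abs] by auto
    qed
    show ?thesis
      using DERIV_powr[OF * _ DERIV_const[of q]] x by (simp add: powr_diff mult_ac)
  qed
  have "(gen_gauss p has_real_derivative - (q * \<bar>x\<bar> powr (q - 1) * sgn x) * gen_gauss p x) (at x)"
    unfolding gen_gauss_eq[abs_def] q
    by (rule DERIV_cong[OF DERIV_cdivide[OF DERIV_fun_exp[OF DERIV_minus[OF 1]]]]) simp
  then have "deriv (gen_gauss p) x = - (q * \<bar>x\<bar> powr (q - 1) * sgn x) * gen_gauss p x"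
    by (rule DERIV_imp_deriv)
  moreover have "gen_gauss p x \<noteq> 0" using Z by (simp add: gen_gauss_eq q)
  ultimately show ?thesis by simp
qed

text \<open>Because \<open>(q - 1) p = q\<close>, the Fisher integral is \<open>q^p\<close> times
  the moment \<open>1 / q\<close>; because \<open>1 - 1 / p = 1 / q\<close>, its \<open>p\<close>-th
  root is \<open>q^(1/q)\<close>.\<close>

lemma K1_eq:
  assumes q: "holder_conj p = q" and p: "p > 1"
  shows "K1 p = gg_bound q"
proof -
  have q': "q = p / (p - 1)" using q by (simp add: holder_conj_def)
  then have q0: "q > 0" using p by simp
  have pq: "(q - 1) * p = q" and pq': "1 - 1 / p = 1 / q"
    using p unfolding q' by (auto simp: field_simps)
  have [measurable]: "gen_gauss p \<in> borel_measurable borel" unfolding gen_gauss_def[abs_def] by measurable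
  \<comment> \<open>The value of the integrand at the origin, left unevaluated since the point is
    null.\<close>
  define c where "c = \<bar>deriv (gen_gauss p) 0 / gen_gauss p 0\<bar> powr p * gen_gauss p 0"
  have eq: "\<bar>deriv (gen_gauss p) x / gen_gauss p x\<bar> powr p * gen_gauss p x
      = (if x = 0 then c else q powr p * (\<bar>x\<bar> powr q * gen_gauss p x))" for x
  proof (cases "x = 0")
    case False
    have "\<bar>deriv (gen_gauss p) x / gen_gauss p x\<bar> = q * \<bar>x\<bar> powr (q - 1)"
      using False q0 by (simp only: gen_gauss_log_deriv[OF q q0 False]) (simp add: abs_mult)
    then show ?thesis using False q0 by (simp only: if_False) (simp add: powr_mult powr_powr pq)
  qed (simp add: c_def)
  have "(\<integral>x. \<bar>deriv (gen_gauss p) x / gen_gauss p x\<bar> powr p * gen_gauss p x \<partial>lborel)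
      = (\<integral>x. q powr p * (\<bar>x\<bar> powr q * gen_gauss p x) \<partial>lborel)"
    unfolding eq
  proof (rule integral_cong_AE)
    show "AE x in lborel. (if x = 0 then c else q powr p * (\<bar>x\<bar> powr q * gen_gauss p x))
        = q powr p * (\<bar>x\<bar> powr q * gen_gauss p x)"
      using AE_lborel_singleton[of "0::real"] by eventually_elim simp
  qed measurable
  also have "\<dots> = q powr p / q" using moment_gen_gauss[OF q q0] by simp
  finally have "fisher_dev p (gen_gauss p) = (q powr p / q) powr (1 / p)"
    by (simp add: fisher_dev_def)
  also have "\<dots> = q powr (1 - 1 / p)"
    using q0 p by (simp add: powr_divide powr_powr powr_diff)
  finally have "fisher_dev p (gen_gauss p) = q powr (1 / q)" by (simp add: pq')
  then show ?thesis
    using entropy_power_gen_gauss[OF q q0] q0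
    by (simp add: K1_def gg_bound_def powr_mult powr_def[of "exp 1"])
qed

section \<open>Comparison of a measure with Lebesgue measure through its sublevel sets\<close>

text \<open>Layer-cake argument: both integrals are integrals over positive levels \<open>s\<close>
  of the measure of a superlevel set. For decreasing \<open>\<phi>\<close> that set is an initial
  piece of the half line, where the hypothesis bounds the mass by the length.\<close>

lemma nn_integral_antimono_le:
  fixes Y :: "'a \<Rightarrow> real" and \<phi> :: "real \<Rightarrow> real"
  assumes M: "sigma_finite_measure M"
    and Y[measurable]: "Y \<in> borel_measurable M" and Y0: "\<And>x. 0 \<le> Y x"
    and le: "\<And>u. 0 \<le> u \<Longrightarrow> emeasure M {x \<in> space M. Y x \<le> u} \<le> ennreal u"
    and \<phi>[measurable]: "\<phi> \<in> borel_measurable borel" and anti: "antimono_on {0..} \<phi>"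
  shows "(\<integral>\<^sup>+x. ennreal (\<phi> (Y x)) \<partial>M) \<le> (\<integral>\<^sup>+v\<in>{0..}. ennreal (\<phi> v) \<partial>lborel)"
proof -
  interpret M: sigma_finite_measure M by fact
  interpret P: pair_sigma_finite M lborel ..
  have eq: "ennreal v = (\<integral>\<^sup>+s. indicator {0<..} s * indicator {s. s < v} s \<partial>lborel)" for v :: real
  proof -
    have "(\<integral>\<^sup>+s. indicator {0<..} s * indicator {s. s < v} s \<partial>lborel) = (\<integral>\<^sup>+s. indicator {0<..<v} s \<partial>lborel)"
      by (intro nn_integral_cong) (auto simp: indicator_def)
    then show ?thesis by (cases "0 \<le> v") (auto simp: ennreal_neg)
  qed
  have level: "emeasure M {x \<in> space M. s < \<phi> (Y x)} \<le> emeasure lborel {v. 0 \<le> v \<and> s < \<phi> v}" for s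
  proof -
    let ?S = "{v. 0 \<le> v \<and> s < \<phi> v}"
    have dn: "v \<in> ?S" if "v' \<in> ?S" "0 \<le> v" "v \<le> v'" for v v'
      using that monotone_onD[OF anti, of v v'] by auto
    show ?thesis
    proof (cases "bdd_above ?S")
      case True
      show ?thesis
      proof (cases "?S = {}")
        case e: True
        then have "{x \<in> space M. s < \<phi> (Y x)} = {}" using Y0 by blast
        then show ?thesis by (simp only: emeasure_empty) simp
      next
        case False
        \<comment> \<open>The superlevel set is \<open>[0, r)\<close> or \<open>[0, r]\<close>. The
          closed sublevel \<open>Y \<le> r\<close> covers both cases from above, and
          \<open>[0, r)\<close> already has length \<open>r\<close>.\<close>
        define r where "r = Sup ?S"
        have r0: "0 \<le> r" using False True by (auto simp: r_def intro: cSup_upper2)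
        have "{x \<in> space M. s < \<phi> (Y x)} \<subseteq> {x \<in> space M. Y x \<le> r}"
          using True Y0 by (auto simp: r_def intro: cSup_upper)
        then have "emeasure M {x \<in> space M. s < \<phi> (Y x)} \<le> emeasure M {x \<in> space M. Y x \<le> r}"
          by (intro emeasure_mono) auto
        also have "\<dots> \<le> ennreal r" using le r0 by simp
        also have "\<dots> = emeasure lborel {0..<r}" using r0 by simp
        also have "\<dots> \<le> emeasure lborel ?S"
        proof (intro emeasure_mono)
          show "{0..<r} \<subseteq> ?S"
          proof
            fix v assume v: "v \<in> {0..<r}"
            then obtain v' where "v' \<in> ?S" "v < v'"
              using False True less_cSup_iff[of ?S v] by (auto simp: r_def)
            then show "v \<in> ?S" using dn[of v' v] v by simp
          qed
        qed auto
        finally show ?thesis .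
      qed
    next
      \<comment> \<open>An unbounded initial piece is the whole half line, and its infinite length
        makes the bound trivial.\<close>
      case False
      have "?S = {0..}"
      proof safe
        fix v :: real assume "0 \<le> v"
        obtain v' where "v' \<in> ?S" "v \<le> v'" using False by (meson bdd_above.I linear)
        then show "s < \<phi> v" using dn[of v' v] \<open>0 \<le> v\<close> by simp
      qed
      moreover have "emeasure lborel {0::real..} = \<infinity>"
      proof -
        have "of_nat n \<le> emeasure lborel {0::real..}" for n
          using emeasure_mono[of "{0..real n}" "{0..}" lborel] by (simp add: ennreal_of_nat_eq_real_of_nat)
        then show ?thesis by (metis SUP_least ennreal_SUP_of_nat_eq_top infinity_ennreal_def top.extremum_unique)
      qed
      ultimately show ?thesis by simp
    qed
  qed
  have "(\<integral>\<^sup>+x. ennreal (\<phi> (Y x)) \<partial>M)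
      = (\<integral>\<^sup>+x. \<integral>\<^sup>+s. indicator {0<..} s * indicator {s. s < \<phi> (Y x)} s \<partial>lborel \<partial>M)"
    by (intro nn_integral_cong eq)
  also have "\<dots> = (\<integral>\<^sup>+s. \<integral>\<^sup>+x. indicator {0<..} s * indicator {s. s < \<phi> (Y x)} s \<partial>M \<partial>lborel)"
    by (rule P.Fubini'[symmetric]) (simp add: indicator_def split_beta', measurable)
  also have "\<dots> = (\<integral>\<^sup>+s. indicator {0<..} s * emeasure M {x \<in> space M. s < \<phi> (Y x)} \<partial>lborel)"
  proof (intro nn_integral_cong)
    fix s :: real
    have "(\<integral>\<^sup>+x. indicator {0<..} s * indicator {s. s < \<phi> (Y x)} s \<partial>M)
        = (\<integral>\<^sup>+x. indicator {0<..} s * indicator {x \<in> space M. s < \<phi> (Y x)} x \<partial>M)"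
      by (intro nn_integral_cong) (auto simp: indicator_def)
    also have "\<dots> = indicator {0<..} s * emeasure M {x \<in> space M. s < \<phi> (Y x)}"
      by (subst nn_integral_cmult) auto
    finally show "(\<integral>\<^sup>+x. indicator {0<..} s * indicator {s. s < \<phi> (Y x)} s \<partial>M)
      = indicator {0<..} s * emeasure M {x \<in> space M. s < \<phi> (Y x)}" .
  qed
  also have "\<dots> \<le> (\<integral>\<^sup>+s. indicator {0<..} s * emeasure lborel {v. 0 \<le> v \<and> s < \<phi> v} \<partial>lborel)"
    by (intro nn_integral_mono mult_left_mono level) auto
  also have "\<dots> = (\<integral>\<^sup>+s. \<integral>\<^sup>+v. indicator {0<..} s * indicator {s. s < \<phi> v} s * indicator {0..} v \<partial>lborel \<partial>lborel)"
  proof (intro nn_integral_cong)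
    fix s :: real
    have "(\<integral>\<^sup>+v. indicator {0<..} s * indicator {s. s < \<phi> v} s * indicator {0..} v \<partial>lborel)
        = (\<integral>\<^sup>+v. indicator {0<..} s * indicator {v. 0 \<le> v \<and> s < \<phi> v} v \<partial>lborel)"
      by (intro nn_integral_cong) (auto simp: indicator_def)
    also have "\<dots> = indicator {0<..} s * emeasure lborel {v. 0 \<le> v \<and> s < \<phi> v}"
      by (subst nn_integral_cmult) auto
    finally show "indicator {0<..} s * emeasure lborel {v. 0 \<le> v \<and> s < \<phi> v}
      = (\<integral>\<^sup>+v. indicator {0<..} s * indicator {s. s < \<phi> v} s * indicator {0..} v \<partial>lborel)" by simp
  qed
  also have "\<dots> = (\<integral>\<^sup>+v. \<integral>\<^sup>+s. indicator {0<..} s * indicator {s. s < \<phi> v} s * indicator {0..} v \<partial>lborel \<partial>lborel)"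
    by (rule lborel_pair.Fubini'[symmetric]) (simp add: indicator_def split_beta')
  also have "\<dots> = (\<integral>\<^sup>+v\<in>{0..}. ennreal (\<phi> v) \<partial>lborel)"
  proof (intro nn_integral_cong)
    fix v :: real
    have "(\<integral>\<^sup>+s. indicator {0<..} s * indicator {s. s < \<phi> v} s * indicator {0..} v \<partial>lborel)
      = (\<integral>\<^sup>+s. indicator {0<..} s * indicator {s. s < \<phi> v} s \<partial>lborel) * indicator {0..} v"
      by (rule nn_integral_multc) simp
    then show "(\<integral>\<^sup>+s. indicator {0<..} s * indicator {s. s < \<phi> v} s * indicator {0..} v \<partial>lborel)
      = ennreal (\<phi> v) * indicator {0..} v"
      by (simp only: eq[of "\<phi> v"])
  qed
  finally show ?thesis .
qed

text \<open>Points of the sublevel set increase to its supremum, and the integral of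
  \<open>k\<close> up to each of them is a value of \<open>Y\<close>, hence at most
  \<open>u\<close>. With \<open>Y\<close> as new variable this says that \<open>k dx\<close> gives
  \<open>[0, u]\<close> mass at most \<open>u\<close>.\<close>

lemma nn_integral_sublevel_le:
  fixes k :: "real \<Rightarrow> ennreal" and a b :: ereal and u :: ennreal
  assumes k[measurable]: "k \<in> borel_measurable borel"
  defines "Y \<equiv> \<lambda>x::real. \<integral>\<^sup>+s\<in>einterval a (ereal x). k s \<partial>lborel"
  shows "(\<integral>\<^sup>+x\<in>{x \<in> einterval a b. Y x \<le> u}. k x \<partial>lborel) \<le> u"
proof -
  let ?A = "{x \<in> einterval a b. Y x \<le> u}"
  show ?thesis
  proof (cases "?A = {}")
    case True
    then show ?thesis by (simp only: True) simp
  next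
    case False
    then have "ereal ` ?A \<noteq> {}" by simp
    from Sup_countable_SUP[OF this] obtain F :: "nat \<Rightarrow> ereal" where
      F: "incseq F" "range F \<subseteq> ereal ` ?A" "Sup (ereal ` ?A) = (SUP i. F i)" by auto
    have ex: "\<exists>r. F n = ereal r \<and> r \<in> ?A" for n using F(2) by fastforce
    define B where "B = (\<Union>n. einterval a (F n))"
    \<comment> \<open>If the supremum is a real number, it may belong to the sublevel set without
      lying in \<open>B\<close>; this costs one null point.\<close>
    define C where "C = {s. ereal s = (SUP i. F i)}"
    have C: "finite C" unfolding C_def by (rule finite_subset[of _ "{real_of_ereal (SUP i. F i)}"]) (auto, metis real_of_ereal.simps(1))
    have sub: "?A \<subseteq> B \<union> C"
    proof
      fix x assume x: "x \<in> ?A"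
      then have "ereal x \<le> (SUP i. F i)" unfolding F(3)[symmetric] by (intro Sup_upper) auto
      then consider "ereal x = (SUP i. F i)" | "ereal x < (SUP i. F i)" by fastforce
      then show "x \<in> B \<union> C"
        using x by cases (auto simp: B_def C_def less_SUP_iff einterval_iff)
    qed
    have "(\<integral>\<^sup>+x\<in>?A. k x \<partial>lborel) \<le> (\<integral>\<^sup>+x\<in>B \<union> C. k x \<partial>lborel)"
      using sub by (intro nn_integral_mono) (auto simp: indicator_def)
    also have "\<dots> = (\<integral>\<^sup>+x\<in>B. k x \<partial>lborel)"
    proof (rule nn_integral_cong_AE)
      have "AE x in lborel. x \<notin> C" using C by (intro AE_not_in) (simp add: finite_imp_null_set_lborel)
      then show "AE x in lborel. k x * indicator (B \<union> C) x = k x * indicator B x"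
        by eventually_elim (auto simp: indicator_def)
    qed
    also have "\<dots> = (SUP n. \<integral>\<^sup>+x\<in>einterval a (F n). k x \<partial>lborel)"
      unfolding B_def
    proof (rule nn_integral_UN_incseq)
      show "incseq (\<lambda>n. einterval a (F n))"
        using F(1) unfolding incseq_def by (auto simp: einterval_iff) (meson less_le_trans)
    qed auto
    also have "\<dots> \<le> u"
    proof (rule SUP_least)
      fix n show "(\<integral>\<^sup>+x\<in>einterval a (F n). k x \<partial>lborel) \<le> u"
        using ex[of n] by (auto simp: Y_def)
    qed
    finally show ?thesis .
  qed
qed

section \<open>The moment-entropy inequality\<close>

lemma epowr_meas[measurable]: "(\<lambda>x. epowr x q) \<in> borel_measurable borel"
  unfolding epowr_def[abs_def] by measurable

text \<open>The support hypotheses are recast as two integrals over \<open>\<Omega>\<close>, so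
  values at the end points and beyond never enter.\<close>

locale density_pair =
  fixes f h :: "real \<Rightarrow> real" and xi xf :: ereal and \<alpha> :: real and \<Omega> :: "real set"
  defines "\<Omega> \<equiv> einterval xi xf"
  assumes xi_xf: "xi < xf"
    and f_meas[measurable]: "f \<in> borel_measurable borel"
    and h_meas[measurable]: "h \<in> borel_measurable borel"
    and f_pos: "\<And>x. x \<in> \<Omega> \<Longrightarrow> f x > 0"
    and h_pos: "\<And>x. x \<in> \<Omega> \<Longrightarrow> h x > 0"
    and int_f: "(\<integral>\<^sup>+x\<in>\<Omega>. ennreal (f x) \<partial>lborel) = 1"
    and int_h: "(\<integral>\<^sup>+x\<in>\<Omega>. ennreal (h x) \<partial>lborel) = 1"
    and \<alpha>_pos: "\<alpha> > 0"
begin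

lemma \<Omega>_meas[measurable]: "\<Omega> \<in> sets borel"
  by (simp add: \<Omega>_def)

text \<open>The bound \<open>ln t \<le> t - 1\<close> at \<open>t = h / f\<close> dominates the
  negative part by \<open>h\<close>, which has mass one.\<close>

lemma KL_neg_finite:
  "(\<integral>\<^sup>+x\<in>\<Omega>. ennreal (- (f x * ln (f x / h x))) \<partial>lborel) < \<infinity>"
proof -
  have "(\<integral>\<^sup>+x\<in>\<Omega>. ennreal (- (f x * ln (f x / h x))) \<partial>lborel) \<le> (\<integral>\<^sup>+x\<in>\<Omega>. ennreal (h x) \<partial>lborel)"
  proof (intro nn_integral_mono)
    fix x
    have "- (f x * ln (f x / h x)) \<le> h x" if "x \<in> \<Omega>"
    proof -
      have p: "f x > 0" "h x > 0" using that f_pos h_pos by auto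
      then have "- ln (f x / h x) \<le> h x / f x - 1"
        using ln_le_minus_one[of "h x / f x"] by (simp add: ln_div)
      then have "f x * (- ln (f x / h x)) \<le> f x * (h x / f x - 1)" using p by (intro mult_left_mono) auto
      then show ?thesis using p by (simp add: algebra_simps)
    qed
    then show "ennreal (- (f x * ln (f x / h x))) * indicator \<Omega> x \<le> ennreal (h x) * indicator \<Omega> x"
      by (auto simp: indicator_def intro: ennreal_leI)
  qed
  also have "\<dots> < \<infinity>" using int_h by simp
  finally show ?thesis .
qed

lemma KL_top:
  assumes "(\<integral>\<^sup>+x\<in>\<Omega>. ennreal (f x * ln (f x / h x)) \<partial>lborel) = \<infinity>"
  shows "KL_div xi xf f h = \<infinity>"
  using assms KL_neg_finite unfolding KL_div_def \<Omega>_def[symmetric]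
  by (cases "\<integral>\<^sup>+x\<in>\<Omega>. ennreal (- (f x * ln (f x / h x))) \<partial>lborel" rule: ennreal_cases) (auto simp: top_ereal_def)

text \<open>The real value of the divergence; by \<open>KL_real\<close> it agrees with
  \<open>KL_div\<close> when the positive part has a finite integral.\<close>

definition rel_ent :: real where
  "rel_ent = (\<integral>x. indicator \<Omega> x * (f x * ln (f x / h x)) \<partial>lborel)"

lemma
  assumes "(\<integral>\<^sup>+x\<in>\<Omega>. ennreal (f x * ln (f x / h x)) \<partial>lborel) \<noteq> \<infinity>"
  shows KL_integrable: "integrable lborel (\<lambda>x. indicator \<Omega> x * (f x * ln (f x / h x)))"
    and KL_real: "KL_div xi xf f h = ereal rel_ent"
proof -
  let ?g = "\<lambda>x. indicator \<Omega> x * (f x * ln (f x / h x))"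
  have e: "(\<integral>\<^sup>+x. ennreal (?g x) \<partial>lborel) = (\<integral>\<^sup>+x\<in>\<Omega>. ennreal (f x * ln (f x / h x)) \<partial>lborel)"
    "(\<integral>\<^sup>+x. ennreal (- ?g x) \<partial>lborel) = (\<integral>\<^sup>+x\<in>\<Omega>. ennreal (- (f x * ln (f x / h x))) \<partial>lborel)"
    by (auto intro!: nn_integral_cong simp: indicator_def)
  show i: "integrable lborel ?g"
    unfolding real_integrable_def e using assms KL_neg_finite by auto
  show "KL_div xi xf f h = ereal rel_ent"
    unfolding rel_ent_def real_lebesgue_integral_def[OF i] e KL_div_def \<Omega>_def[symmetric]
    using assms KL_neg_finite
    by (cases "\<integral>\<^sup>+x\<in>\<Omega>. ennreal (- (f x * ln (f x / h x))) \<partial>lborel" rule: ennreal_cases;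
        cases "\<integral>\<^sup>+x\<in>\<Omega>. ennreal (f x * ln (f x / h x)) \<partial>lborel" rule: ennreal_cases) auto
qed

lemma f_integrable: "integrable lborel (\<lambda>x. indicator \<Omega> x * f x)"
  and f_integral: "(\<integral>x. indicator \<Omega> x * f x \<partial>lborel) = 1"
proof -
  have e: "(\<integral>\<^sup>+x. ennreal (indicator \<Omega> x * f x) \<partial>lborel) = 1"
    unfolding int_f[symmetric] by (auto intro!: nn_integral_cong simp: indicator_def)
  have n: "0 \<le> indicator \<Omega> x * f x" for x using f_pos[of x] by (auto simp: indicator_def)
  show "integrable lborel (\<lambda>x. indicator \<Omega> x * f x)"
    using e n by (intro integrableI_nonneg) auto
  show "(\<integral>x. indicator \<Omega> x * f x \<partial>lborel) = 1"
    using e n by (subst integral_eq_nn_integral) auto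
qed

text \<open>A vanishing integral would make \<open>\<Omega>\<close> a null set, contradicting the
  mass one of \<open>f\<close>.\<close>

lemma nn_integral_neq_0:
  assumes [measurable]: "F \<in> borel_measurable borel" and "\<And>x. x \<in> \<Omega> \<Longrightarrow> F x \<noteq> 0"
  shows "(\<integral>\<^sup>+x\<in>\<Omega>. F x \<partial>lborel) \<noteq> 0"
proof
  assume "(\<integral>\<^sup>+x\<in>\<Omega>. F x \<partial>lborel) = 0"
  then have "AE x in lborel. F x * indicator \<Omega> x = 0" by (subst (asm) nn_integral_0_iff_AE) auto
  then have "AE x in lborel. ennreal (f x) * indicator \<Omega> x = 0"
    by eventually_elim (use assms in \<open>auto simp: indicator_def split: if_splits\<close>)
  then have "(\<integral>\<^sup>+x\<in>\<Omega>. ennreal (f x) \<partial>lborel) = 0" by (subst nn_integral_0_iff_AE) auto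
  then show False using int_f by simp
qed

section \<open>The escort variable measured from the left end point, and Gibbs' inequality\<close>

definition k :: "real \<Rightarrow> real" where
  "k x = f x powr (1 - \<alpha>) * h x powr \<alpha>"

lemma k_meas[measurable]: "k \<in> borel_measurable borel"
  unfolding k_def[abs_def] by measurable

lemma k_pos: "x \<in> \<Omega> \<Longrightarrow> k x > 0"
  using f_pos h_pos by (simp add: k_def less_imp_neq[symmetric])

text \<open>In other words \<open>ln (f / k) = \<alpha> ln (f / h)\<close>: this is how the
  divergence appears as an entropy in the new variable.\<close>

lemma k_eq: "x \<in> \<Omega> \<Longrightarrow> k x = f x * exp (- \<alpha> * ln (f x / h x))"
  using f_pos[of x] h_pos[of x]
  by (simp add: k_def powr_def ln_div algebra_simps exp_diff exp_add)

definition Y :: "real \<Rightarrow> ennreal" where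
  "Y x = (\<integral>\<^sup>+s\<in>einterval xi (ereal x). ennreal (k s) \<partial>lborel)"

text \<open>The moving end point is encoded in a kernel that is jointly measurable in
  \<open>(x, s)\<close>, so that parametrized integration applies.\<close>

lemma Y_meas[measurable]: "Y \<in> borel_measurable borel"
proof -
  have "(\<lambda>x. \<integral>\<^sup>+s. ennreal (k s) * indicator {p. xi < ereal (snd p) \<and> ereal (snd p) < ereal (fst p)} (x, s) \<partial>lborel)
      \<in> borel_measurable borel" by measurable
  also have "(\<lambda>x. \<integral>\<^sup>+s. ennreal (k s) * indicator {p. xi < ereal (snd p) \<and> ereal (snd p) < ereal (fst p)} (x, s) \<partial>lborel) = Y"
    unfolding Y_def by (intro ext nn_integral_cong) (auto simp: indicator_def einterval_iff)
  finally show ?thesis .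
qed

lemma Y_pos:
  assumes "x \<in> \<Omega>" shows "Y x \<noteq> 0"
proof
  assume "Y x = 0"
  then have "AE s in lborel. ennreal (k s) * indicator (einterval xi (ereal x)) s = 0"
    unfolding Y_def by (subst (asm) nn_integral_0_iff_AE) auto
  then have "AE s in lborel. s \<notin> einterval xi (ereal x)"
  proof eventually_elim
    case (elim s)
    show ?case
    proof
      assume s: "s \<in> einterval xi (ereal x)"
      then have "s \<in> \<Omega>" using assms less_trans[of "ereal s" "ereal x" xf] by (auto simp: \<Omega>_def einterval_iff)
      then show False using elim s k_pos[of s] by (auto simp: indicator_def ennreal_eq_0_iff)
    qed
  qed
  then have "emeasure lborel (einterval xi (ereal x)) = 0"
    using AE_iff_measurable[of "einterval xi (ereal x)" lborel "\<lambda>s. s \<notin> einterval xi (ereal x)"] by auto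
  moreover obtain c where c: "xi < ereal c" "c < x"
    using einterval_nonempty[of xi "ereal x"] assms by (auto simp: \<Omega>_def einterval_iff)
  moreover have "emeasure lborel {c<..<x} \<le> emeasure lborel (einterval xi (ereal x))"
    using c less_trans[of xi "ereal c"] by (intro emeasure_mono) (auto simp: einterval_iff)
  ultimately show False by (simp add: ennreal_eq_0_iff)
qed

text \<open>The comparison lemma is applied to the measure \<open>k dx\<close> on
  \<open>\<Omega>\<close>, the variable \<open>Y\<close> and the decreasing function
  \<open>exp (- t v^q)\<close>; scaling by \<open>t^(1/q)\<close> then reduces to
  \<open>gg_const\<close>. This bounds the mass of the trial density in Gibbs' inequality.\<close>

lemma nn_integral_exp_escort_le:
  assumes q: "q > 0" and t: "t > 0" and fin: "AE x in lborel. x \<in> \<Omega> \<longrightarrow> Y x < \<infinity>"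
  shows "(\<integral>\<^sup>+x\<in>\<Omega>. ennreal (exp (- t * enn2real (Y x) powr q) * k x) \<partial>lborel)
         \<le> ennreal (t powr (- 1 / q) * gg_const q)"
proof -
  let ?y = "\<lambda>x. enn2real (Y x)"
  let ?M = "density lborel (\<lambda>x. ennreal (k x * indicator \<Omega> x))"
  have kn: "0 \<le> k x" for x by (simp add: k_def)
  have sf: "sigma_finite_measure ?M"
    by (subst sigma_finite_measure.sigma_finite_iff_density_finite[OF sigma_finite_lborel]) auto
  have "(\<integral>\<^sup>+x\<in>\<Omega>. ennreal (exp (- t * ?y x powr q) * k x) \<partial>lborel)
      = (\<integral>\<^sup>+x. ennreal (exp (- t * ?y x powr q)) \<partial>?M)"
    by (subst nn_integral_density)
      (auto intro!: nn_integral_cong simp: indicator_def kn ennreal_mult'' mult.commute)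
  also have "\<dots> \<le> (\<integral>\<^sup>+v\<in>{0..}. ennreal (exp (- t * v powr q)) \<partial>lborel)"
  proof (rule nn_integral_antimono_le[OF sf])
    fix u :: real assume u: "0 \<le> u"
    have "emeasure ?M {x \<in> space ?M. ?y x \<le> u} = (\<integral>\<^sup>+x\<in>{x. ?y x \<le> u}. ennreal (k x * indicator \<Omega> x) \<partial>lborel)"
      by (subst emeasure_density) auto
    also have "\<dots> \<le> (\<integral>\<^sup>+x\<in>{x \<in> \<Omega>. Y x \<le> ennreal u}. ennreal (k x) \<partial>lborel)"
    proof (rule nn_integral_mono_AE)
      show "AE x in lborel. ennreal (k x * indicator \<Omega> x) * indicator {x. ?y x \<le> u} x
        \<le> ennreal (k x) * indicator {x \<in> \<Omega>. Y x \<le> ennreal u} x"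
        using fin
      proof eventually_elim
        case (elim x)
        \<comment> \<open>Where \<open>Y x = \<infinity>\<close>, the real value \<open>?y x\<close>
          is \<open>0\<close> and \<open>x\<close> would lie in every sublevel set;
          \<open>fin\<close> excludes this almost everywhere.\<close>
        have "Y x \<le> ennreal u" if "x \<in> \<Omega>" "?y x \<le> u"
          using that elim u by (cases "Y x" rule: ennreal_cases) auto
        then show ?case by (auto simp: indicator_def)
      qed
    qed
    also have "\<dots> \<le> ennreal u"
      unfolding \<Omega>_def Y_def by (rule nn_integral_sublevel_le) measurable
    finally show "emeasure ?M {x \<in> space ?M. ?y x \<le> u} \<le> ennreal u" .
  next
    show "antimono_on {0..} (\<lambda>v. exp (- t * v powr q))"
      using q t by (intro monotone_onI) (auto intro!: powr_mono2)
  qed auto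
  \<comment> \<open>Enlarging the half line to the line gives away a factor two; the constant
    \<open>K0\<close> belongs to the two-sided Gaussian.\<close>
  also have "\<dots> \<le> (\<integral>\<^sup>+v. ennreal (exp (- (\<bar>t powr (1 / q) * v\<bar> powr q))) \<partial>lborel)"
    using q t by (intro nn_integral_mono) (auto simp: indicator_def abs_mult powr_mult powr_powr)
  also have "\<dots> = ennreal (t powr (- 1 / q)) * (\<integral>\<^sup>+v. ennreal (exp (- (\<bar>v\<bar> powr q))) \<partial>lborel)"
  proof -
    have "(\<integral>\<^sup>+v. ennreal (exp (- (\<bar>v\<bar> powr q))) \<partial>lborel)
      = ennreal (t powr (1 / q)) * (\<integral>\<^sup>+v. ennreal (exp (- (\<bar>t powr (1 / q) * v\<bar> powr q))) \<partial>lborel)"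
      using t nn_integral_real_affine[of "\<lambda>v. ennreal (exp (- (\<bar>v\<bar> powr q)))" "t powr (1 / q)" 0] by simp
    then show ?thesis using t by (simp add: powr_minus field_simps flip: mult.assoc ennreal_mult)
  qed
  also have "(\<integral>\<^sup>+v. ennreal (exp (- (\<bar>v\<bar> powr q))) \<partial>lborel) = ennreal (gg_const q)"
    unfolding gg_const_def using gg_integrable[OF q] by (intro nn_integral_eq_integral) auto
  finally show ?thesis using gg_const_pos[OF q] by (simp add: ennreal_mult'')
qed

lemma rel_moment_eq: "rel_moment q \<alpha> xi xf f h = (\<integral>\<^sup>+x\<in>\<Omega>. epowr (Y x) q * ennreal (f x) \<partial>lborel)"
  by (simp add: rel_moment_def \<Omega>_def Y_def k_def)

text \<open>Gibbs' inequality between \<open>f\<close> and the trial density \<open>G\<close>: the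
  mean of \<open>ln (G / f)\<close> under \<open>f\<close> is at most zero, and it is an explicit
  expression in the moment and the divergence.\<close>

lemma moment_entropy_finite:
  assumes q: "q > 0" and m: "m > 0"
    and M: "rel_moment q \<alpha> xi xf f h = ennreal m"
    and KL: "(\<integral>\<^sup>+x\<in>\<Omega>. ennreal (f x * ln (f x / h x)) \<partial>lborel) \<noteq> \<infinity>"
  shows "1 / gg_bound q \<le> m powr (1 / q) * exp (\<alpha> * rel_ent)"
proof -
  let ?y = "\<lambda>x. enn2real (Y x)"
  let ?Z = "gg_const q"
  have Z: "?Z > 0" using gg_const_pos q by simp
  have M': "(\<integral>\<^sup>+x\<in>\<Omega>. epowr (Y x) q * ennreal (f x) \<partial>lborel) = ennreal m"
    using M by (simp add: rel_moment_eq)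
  \<comment> \<open>A finite moment forces \<open>Y\<close> to be finite almost everywhere on
    \<open>\<Omega>\<close>, since \<open>f\<close> is positive there.\<close>
  have "AE x in lborel. epowr (Y x) q * ennreal (f x) * indicator \<Omega> x \<noteq> \<infinity>"
    by (rule nn_integral_noteq_infinite) (auto simp: M')
  then have fin: "AE x in lborel. x \<in> \<Omega> \<longrightarrow> Y x < \<infinity>"
  proof eventually_elim
    case (elim x)
    then show ?case using f_pos[of x] q
      by (auto simp: indicator_def epowr_def ennreal_mult_eq_top_iff ennreal_eq_0_iff top.not_eq_extremum split: if_splits)
  qed
  have m_eq: "(\<integral>\<^sup>+x. ennreal (indicator \<Omega> x * (f x * ?y x powr q)) \<partial>lborel) = ennreal m"
    unfolding M'[symmetric]
  proof (rule nn_integral_cong_AE)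
    show "AE x in lborel. ennreal (indicator \<Omega> x * (f x * ?y x powr q)) = epowr (Y x) q * ennreal (f x) * indicator \<Omega> x"
      using fin
    proof eventually_elim
      case (elim x)
      then show ?case using f_pos[of x] q Y_pos[of x]
        by (auto simp: indicator_def epowr_def ennreal_mult'' mult.commute)
    qed
  qed
  have yint: "integrable lborel (\<lambda>x. indicator \<Omega> x * (f x * ?y x powr q))"
  proof (rule integrableI_nonneg)
    show "AE x in lborel. 0 \<le> indicator \<Omega> x * (f x * ?y x powr q)"
      using f_pos by (intro AE_I2) (auto simp: indicator_def less_imp_le)
  qed (auto simp: m_eq)
  have ym: "(\<integral>x. indicator \<Omega> x * (f x * ?y x powr q) \<partial>lborel) = m"
  proof (subst integral_eq_nn_integral)
    show "AE x in lborel. 0 \<le> indicator \<Omega> x * (f x * ?y x powr q)"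
      using f_pos by (intro AE_I2) (auto simp: indicator_def less_imp_le)
  qed (use m in \<open>auto simp: m_eq\<close>)
  \<comment> \<open>The maximizer of \<open>(1 / q) ln t - t m\<close>, the part of the bound that
    depends on \<open>t\<close>; it makes \<open>t m = 1 / q\<close>.\<close>
  define t where "t = 1 / (q * m)"
  have t: "t > 0" using q m by (simp add: t_def)
  \<comment> \<open>The reciprocal of the mass bound for \<open>exp (- t Y^q) k\<close>, so that
    \<open>G\<close> has mass at most one.\<close>
  define c where "c = t powr (1 / q) / ?Z"
  have c: "c > 0" using t Z by (simp add: c_def)
  define G where "G x = indicator \<Omega> x * (c * (exp (- t * ?y x powr q) * k x))" for x
  have [measurable]: "G \<in> borel_measurable borel" unfolding G_def by measurable
  have Gn: "0 \<le> G x" for x using c by (simp add: G_def k_def)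
  have Gle: "(\<integral>\<^sup>+x. ennreal (G x) \<partial>lborel) \<le> 1"
  proof -
    have "(\<integral>\<^sup>+x. ennreal (G x) \<partial>lborel)
        = (\<integral>\<^sup>+x. ennreal c * (ennreal (exp (- t * ?y x powr q) * k x) * indicator \<Omega> x) \<partial>lborel)"
      using c by (intro nn_integral_cong) (auto simp: G_def indicator_def ennreal_mult' k_def)
    also have "\<dots> = ennreal c * (\<integral>\<^sup>+x\<in>\<Omega>. ennreal (exp (- t * ?y x powr q) * k x) \<partial>lborel)"
      by (rule nn_integral_cmult) measurable
    also have "\<dots> \<le> ennreal c * ennreal (t powr (- 1 / q) * ?Z)"
      by (intro mult_left_mono nn_integral_exp_escort_le q t fin) auto
    also have "\<dots> = ennreal (c * (t powr (- 1 / q) * ?Z))" using c by (simp add: ennreal_mult')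
    also have "c * (t powr (- 1 / q) * ?Z) = 1" using Z t by (simp add: c_def powr_minus field_simps)
    finally show ?thesis by simp
  qed
  have Gint: "integrable lborel G"
    using Gle Gn by (intro integrableI_nonneg) (auto intro: le_less_trans)
  have G1: "(\<integral>x. G x \<partial>lborel) \<le> 1"
    using Gle Gn by (subst integral_eq_nn_integral) (auto simp: enn2real_leI)
  let ?R = "\<lambda>x. ln c * (indicator \<Omega> x * f x) - t * (indicator \<Omega> x * (f x * ?y x powr q))
        - \<alpha> * (indicator \<Omega> x * (f x * ln (f x / h x)))"
  have "(\<integral>x. ?R x \<partial>lborel) \<le> (\<integral>x. G x - indicator \<Omega> x * f x \<partial>lborel)"
  proof (rule integral_mono)
    show "integrable lborel ?R"
      using f_integrable yint KL_integrable[OF KL] by auto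
    show "integrable lborel (\<lambda>x. G x - indicator \<Omega> x * f x)" using Gint f_integrable by auto
    fix x
    show "?R x \<le> G x - indicator \<Omega> x * f x"
    proof (cases "x \<in> \<Omega>")
      case True
      \<comment> \<open>This is \<open>ln (G x / f x)\<close>, by the exponential form of
        \<open>k\<close>.\<close>
      define L where "L = ln c - t * ?y x powr q - \<alpha> * ln (f x / h x)"
      have "L \<le> exp L - 1" using exp_ge_add_one_self[of L] by linarith
      then have "f x * L \<le> f x * (exp L - 1)" using f_pos[OF True] by (intro mult_left_mono) auto
      moreover have "G x = f x * exp L"
        using True c by (simp add: G_def k_eq L_def exp_diff exp_minus exp_add field_simps)
      ultimately show ?thesis using True by (simp add: L_def algebra_simps)
    qed (simp add: G_def)
  qed
  also have "\<dots> \<le> 0" using G1 Gint f_integrable f_integral by simp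
  also have "(\<integral>x. ?R x \<partial>lborel) = ln c - t * m - \<alpha> * rel_ent"
    using f_integrable f_integral yint ym KL_integrable[OF KL] by (simp add: rel_ent_def)
  finally have "ln c - 1 / q \<le> \<alpha> * rel_ent" using m q by (simp add: t_def)
  then have "exp (ln c - 1 / q) \<le> exp (\<alpha> * rel_ent)" by simp
  moreover have "exp (ln c - 1 / q) = c / exp (1 / q)" using c by (simp only: exp_diff exp_ln)
  moreover have "c / exp (1 / q) = 1 / gg_bound q / m powr (1 / q)"
    using q m Z
    by (simp add: c_def t_def gg_bound_def powr_divide powr_mult powr_def[of "exp 1"] mult_ac)
  ultimately have "1 / gg_bound q / m powr (1 / q) \<le> exp (\<alpha> * rel_ent)" by simp
  then show ?thesis using m by (subst (asm) pos_divide_le_eq) (simp_all add: mult.commute)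
qed

text \<open>Beyond the finite case, \<open>0 * \<infinity> = 0\<close> has to be kept out: for
  infinite divergence the moment factor is nonzero, and for infinite moment and real divergence the
  exponential is positive, so each product is infinite.\<close>

lemma moment_entropy:
  assumes q: "q > 0"
  shows "rel_sigma q \<alpha> xi xf f h * exp_ereal (KL_div xi xf f h) \<ge> ennreal ((1 / gg_bound q) powr (1 / \<alpha>))"
proof -
  define M where "M = rel_moment q \<alpha> xi xf f h"
  have M0: "M \<noteq> 0" unfolding M_def rel_moment_eq
  proof (rule nn_integral_neq_0)
    show "(\<lambda>x. epowr (Y x) q * ennreal (f x)) \<in> borel_measurable borel" by measurable
    fix x assume "x \<in> \<Omega>"
    then show "epowr (Y x) q * ennreal (f x) \<noteq> 0"
      using f_pos[of x] Y_pos[of x] q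
      by (auto simp: epowr_def ennreal_eq_0_iff enn2real_eq_0_iff enn2real_positive_iff not_le less_top)
  qed
  have s0: "rel_sigma q \<alpha> xi xf f h \<noteq> 0"
    using M0 q \<alpha>_pos
    by (auto simp: rel_sigma_def M_def[symmetric] epowr_def enn2real_eq_0_iff)
  have qa: "1 / (q * \<alpha>) > 0" using q \<alpha>_pos by simp
  show ?thesis
  proof (cases "(\<integral>\<^sup>+x\<in>\<Omega>. ennreal (f x * ln (f x / h x)) \<partial>lborel) = \<infinity>")
    case True
    then show ?thesis using s0 by (simp add: KL_top exp_ereal_def ennreal_mult_top)
  next
    case False
    note KL = KL_real[OF False]
    show ?thesis
    proof (cases "M = \<infinity>")
      case True
      then show ?thesis using qa q \<alpha>_pos
        by (simp add: rel_sigma_def M_def[symmetric] epowr_def KL exp_ereal_def ennreal_top_mult ennreal_eq_0_iff)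
    next
      case Mf: False
      then obtain m where m: "M = ennreal m" "m > 0"
        using M0 by (cases M rule: ennreal_cases) (auto simp: less_le)
      have "(1 / gg_bound q) powr (1 / \<alpha>) \<le> (m powr (1 / q) * exp (\<alpha> * rel_ent)) powr (1 / \<alpha>)"
        using moment_entropy_finite[OF q m(2) m(1)[unfolded M_def] False] gg_bound_pos[OF q] \<alpha>_pos
        by (intro powr_mono2) auto
      also have "\<dots> = m powr (1 / (q * \<alpha>)) * exp rel_ent"
        using m \<alpha>_pos by (simp add: powr_mult powr_powr powr_def[of "exp _"])
      finally show ?thesis using m qa q \<alpha>_pos
        by (simp add: rel_sigma_def M_def[symmetric] epowr_def KL exp_ereal_def ennreal_leI flip: ennreal_mult'')
    qed
  qed
qed

end

section \<open>Everywhere differentiable functions and distribution functions\<close>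

text \<open>A derivative is a pointwise limit of difference quotients along a fixed null
  sequence.\<close>

lemma borel_measurable_indicator_derivative:
  fixes F F' :: "real \<Rightarrow> real"
  assumes [measurable]: "F \<in> borel_measurable borel" "A \<in> sets borel"
    and F: "\<And>x. x \<in> A \<Longrightarrow> (F has_real_derivative F' x) (at x)"
  shows "(\<lambda>x. indicator A x * F' x) \<in> borel_measurable borel"
proof (rule borel_measurable_LIMSEQ_real)
  show "(\<lambda>x. indicator A x * ((F (x + inverse (real (Suc n))) - F x) / inverse (real (Suc n)))) \<in> borel_measurable borel" for n
    by measurable
  fix x
  show "(\<lambda>n. indicator A x * ((F (x + inverse (real (Suc n))) - F x) / inverse (real (Suc n))))
      \<longlonglongrightarrow> indicator A x * F' x"
  proof (cases "x \<in> A")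
    case True
    have "((\<lambda>h. (F (x + h) - F x) / h) \<longlongrightarrow> F' x) (at 0)" using F[OF True] by (simp add: DERIV_def)
    moreover have "filterlim (\<lambda>n. inverse (real (Suc n))) (at 0) sequentially"
      using LIMSEQ_inverse_real_of_nat by (intro filterlim_atI) auto
    ultimately have "(\<lambda>n. (F (x + inverse (real (Suc n))) - F x) / inverse (real (Suc n))) \<longlonglongrightarrow> F' x"
      by (rule filterlim_compose)
    then show ?thesis by (rule tendsto_mult_left)
  qed simp
qed

text \<open>The gauge integral recovers a function from any everywhere existing derivative. If the
  right-hand side is finite, the derivative is Lebesgue integrable and the two integrals
  agree.\<close>

lemma abs_diff_le_nn_integral_derivative:
  fixes F F' :: "real \<Rightarrow> real"
  assumes ab: "a \<le> b"
    and F: "\<And>x. x \<in> {a..b} \<Longrightarrow> (F has_real_derivative F' x) (at x)"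
    and m: "(\<lambda>x. indicator {a..b} x * F' x) \<in> borel_measurable borel"
  shows "ennreal \<bar>F b - F a\<bar> \<le> (\<integral>\<^sup>+x\<in>{a..b}. ennreal \<bar>F' x\<bar> \<partial>lborel)"
proof (cases "(\<integral>\<^sup>+x\<in>{a..b}. ennreal \<bar>F' x\<bar> \<partial>lborel) = \<infinity>")
  case False
  let ?g = "\<lambda>x. indicator {a..b} x *\<^sub>R F' x"
  have e: "(\<integral>\<^sup>+x. ennreal (norm (?g x)) \<partial>lborel) = (\<integral>\<^sup>+x\<in>{a..b}. ennreal \<bar>F' x\<bar> \<partial>lborel)"
    by (intro nn_integral_cong) (auto simp: indicator_def)
  have int: "set_integrable lborel {a..b} F'"
    unfolding set_integrable_def
  proof (rule integrableI_bounded)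
    show "(\<integral>\<^sup>+x. ennreal (norm (?g x)) \<partial>lborel) < \<infinity>" unfolding e using False by (simp add: less_top)
  qed (use m in simp)
  have "(F' has_integral (F b - F a)) {a..b}"
    using F ab by (intro fundamental_theorem_of_calculus)
      (auto intro: has_field_derivative_at_within simp flip: has_real_derivative_iff_has_vector_derivative)
  then have "F b - F a = (LINT x:{a..b}|lborel. F' x)"
    using set_borel_integral_eq_integral(2)[OF int] by (simp add: integral_unique)
  then show ?thesis
    using integral_norm_bound_ennreal[OF int[unfolded set_integrable_def]] e
    by (simp add: set_lebesgue_integral_def)
qed simp

lemma nn_integral_derivative_Icc:
  fixes F F' :: "real \<Rightarrow> real"
  assumes ab: "a \<le> b"
    and F: "\<And>x. x \<in> {a..b} \<Longrightarrow> (F has_real_derivative F' x) (at x)"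
    and n: "\<And>x. x \<in> {a..b} \<Longrightarrow> 0 \<le> F' x"
  shows "(\<integral>\<^sup>+x\<in>{a..b}. ennreal (F' x) \<partial>lborel) = ennreal (F b - F a)"
proof (rule nn_integral_has_integral_lebesgue'[OF n])
  show "(F' has_integral (F b - F a)) {a..b}"
    using F ab by (intro fundamental_theorem_of_calculus)
      (auto intro: has_field_derivative_at_within simp flip: has_real_derivative_iff_has_vector_derivative)
qed

section \<open>Distribution functions and the quantile function of the generalized Gaussian\<close>

text \<open>It has two instances, \<open>f\<close> cut off to \<open>\<Omega>\<close> and the
  Gaussian, whose distribution functions are combined into the transport map.\<close>

locale lborel_density =
  fixes g :: "real \<Rightarrow> real"
  assumes g_meas[measurable]: "g \<in> borel_measurable borel" and g_nonneg: "\<And>x. 0 \<le> g x"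
    and int_g: "(\<integral>\<^sup>+x. ennreal (g x) \<partial>lborel) = 1"
begin

abbreviation "M \<equiv> density lborel (\<lambda>x. ennreal (g x))"

sublocale real_distribution M
proof -
  interpret prob_space M using int_g by (intro prob_spaceI) (simp add: emeasure_density)
  show "real_distribution M" by unfold_locales simp_all
qed

lemma cdf_cont: "continuous_on UNIV (cdf M)"
proof -
  have "emeasure M {x} = 0" for x by (simp add: emeasure_density)
  then show ?thesis
    unfolding continuous_on_eq_continuous_at[OF open_UNIV] isCont_cdf by (simp add: measure_def)
qed

lemma cdf_surj:
  assumes "0 < u" "u < 1" shows "\<exists>x. cdf M x = u"
proof -
  obtain a where a: "cdf M a < u"
    using order_tendstoD(2)[OF cdf_lim_at_bot assms(1)] by (auto simp: eventually_at_bot_linorder)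
  obtain b where b: "u < cdf M b"
    using order_tendstoD(1)[OF cdf_lim_at_top_prob assms(2)] by (auto simp: eventually_at_top_linorder)
  have "a \<le> b" using a b cdf_nondecreasing[of b a] by linarith
  then show ?thesis using IVT'[of "cdf M" a u b] a b continuous_on_subset[OF cdf_cont] by force
qed

text \<open>On a compact neighbourhood of \<open>x\<close> the distribution function is a constant
  plus the integral of a continuous function.\<close>

lemma cdf_deriv:
  assumes A: "open A" "x \<in> A" "continuous_on A g"
  shows "(cdf M has_real_derivative g x) (at x)"
proof -
  obtain e where e: "e > 0" "cball x e \<subseteq> A" using A open_contains_cball by blast
  define a b where "a = x - e" and "b = x + e"
  have ab: "a < x" "x < b" "{a..b} \<subseteq> A" using e by (auto simp: a_def b_def cball_eq_atLeastAtMost)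
  have cont: "continuous_on {a..b} g" using A(3) ab(3) by (rule continuous_on_subset)
  have eq: "cdf M u = cdf M a + integral {a..u} g" if "u \<in> {a<..<b}" for u
  proof -
    have ig: "(g has_integral (integral {a..u} g)) {a..u}"
      using that by (intro integrable_integral integrable_continuous_interval continuous_on_subset[OF cont]) auto
    have "emeasure M {a<..u} = (\<integral>\<^sup>+x\<in>{a<..u}. ennreal (g x) \<partial>lborel)" by (simp add: emeasure_density)
    also have "\<dots> = (\<integral>\<^sup>+x\<in>{a..u}. ennreal (g x) \<partial>lborel)"
      using AE_lborel_singleton[of a] by (intro nn_integral_cong_AE, eventually_elim) (auto simp: indicator_def)
    also have "\<dots> = ennreal (integral {a..u} g)"
      using ig by (intro nn_integral_has_integral_lebesgue' g_nonneg)
    finally have "measure M {a<..u} = integral {a..u} g"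
      using has_integral_nonneg[OF ig g_nonneg] by (simp add: measure_def)
    then show ?thesis using cdf_diff_eq[of a u] that by simp
  qed
  have "((\<lambda>u. integral {a..u} g) has_real_derivative g x) (at x within {a..b})"
    using ab by (intro integral_has_real_derivative cont) auto
  then have "((\<lambda>u. integral {a..u} g) has_real_derivative g x) (at x)"
    using ab by (simp add: at_within_Icc_at)
  then have "((\<lambda>u. cdf M a + integral {a..u} g) has_real_derivative g x) (at x)"
    by (auto intro!: derivative_eq_intros)
  then show ?thesis
    by (rule has_field_derivative_transform_within_open[of _ _ _ "{a<..<b}"]) (use ab eq in auto)
qed

end

lemma lborel_density_gen_gauss:
  assumes q: "q > 0"
  shows "lborel_density (\<lambda>x. exp (- (\<bar>x\<bar> powr q)) / gg_const q)"
proof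
  have Z: "gg_const q > 0" using gg_const_pos[OF q] .
  then show "0 \<le> exp (- (\<bar>x\<bar> powr q)) / gg_const q" for x by simp
  have "(\<integral>\<^sup>+x. ennreal (exp (- (\<bar>x\<bar> powr q)) / gg_const q) \<partial>lborel)
      = ennreal (\<integral>x. exp (- (\<bar>x\<bar> powr q)) / gg_const q \<partial>lborel)"
    using gg_integrable[OF q] Z by (intro nn_integral_eq_integral) auto
  also have "\<dots> = 1" using Z by (simp add: gg_const_def[symmetric])
  finally show "(\<integral>\<^sup>+x. ennreal (exp (- (\<bar>x\<bar> powr q)) / gg_const q) \<partial>lborel) = 1" .
qed measurable

context
  fixes q :: real and g :: "real \<Rightarrow> real" and G :: "real \<Rightarrow> real"
  assumes q: "q > 0"
  defines "g \<equiv> \<lambda>x. exp (- (\<bar>x\<bar> powr q)) / gg_const q"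
  defines "G \<equiv> cdf (density lborel (\<lambda>x. ennreal (g x)))"
begin

interpretation lborel_density g
  unfolding g_def using q by (rule lborel_density_gen_gauss)

lemma gauss_cdf_deriv: "(G has_real_derivative g x) (at x)"
proof -
  have "continuous_on UNIV g"
    unfolding g_def using q gg_const_pos[OF q] by (intro continuous_intros continuous_on_powr') auto
  then show ?thesis unfolding G_def by (intro cdf_deriv[of UNIV]) auto
qed

lemma gauss_cdf_less: "x < y \<Longrightarrow> G x < G y"
proof (erule DERIV_pos_imp_increasing)
  show "\<exists>D. (G has_real_derivative D) (at z) \<and> 0 < D" for z
    using gauss_cdf_deriv[of z] gg_const_pos[OF q] by (intro exI[of _ "g z"]) (simp add: g_def)
qed

lemma gauss_cdf_range: "0 < G x" "G x < 1"
proof -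
  have "0 \<le> G (x - 1)" "G (x + 1) \<le> 1"
    unfolding G_def by (rule cdf_nonneg, rule cdf_bounded_prob)
  then show "0 < G x" "G x < 1"
    using gauss_cdf_less[of "x - 1" x] gauss_cdf_less[of x "x + 1"] by linarith+
qed

text \<open>\<open>H\<close> is the quantile function. It is continuous as the inverse of a
  continuous injection, and the inverse function rule gives its derivative because \<open>g\<close>
  is positive.\<close>

lemma gauss_cdf_inv:
  "\<exists>H. (\<forall>t. H (G t) = t) \<and>
    (\<forall>u. 0 < u \<longrightarrow> u < 1 \<longrightarrow> G (H u) = u \<and> (H has_real_derivative 1 / g (H u)) (at u))"
proof -
  have inj: "inj G" by (metis gauss_cdf_less injI less_irrefl linorder_neqE)
  define H where "H = inv G"
  have GH: "G (H u) = u" if "0 < u" "u < 1" for u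
    using cdf_surj[OF that] unfolding H_def G_def by (metis f_inv_into_f rangeI)
  have HG: "H (G t) = t" for t using inj by (simp add: H_def)
  have "(H has_real_derivative 1 / g (H u)) (at u)" if u: "0 < u" "u < 1" for u
  proof -
    have "isCont H (G (H u))"
    proof (rule isCont_inverse_function[where d = 1 and f = G and g = H and x = "H u"])
      show "H (G z) = z" "isCont G z" for z using HG DERIV_isCont[OF gauss_cdf_deriv] by auto
    qed simp
    then have c: "isCont H u" using GH[OF u] by simp
    have "(H has_real_derivative inverse (g (H u))) (at u)"
    proof (rule DERIV_inverse_function[where a = 0 and b = 1 and f = G and g = H and x = u])
      show "(G has_real_derivative g (H u)) (at (H u))" by (rule gauss_cdf_deriv)
      show "g (H u) \<noteq> 0" using gg_const_pos[OF q] by (simp add: g_def)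
    qed (use u c GH in auto)
    then show ?thesis by (simp add: inverse_eq_divide)
  qed
  with GH HG show ?thesis by blast
qed

end

section \<open>The escort density at the ends of the interval\<close>

locale escort_pair = density_pair +
  fixes y :: "real \<Rightarrow> real"
  assumes f_diff: "\<And>x. x \<in> \<Omega> \<Longrightarrow> f differentiable (at x)"
    and h_diff: "\<And>x. x \<in> \<Omega> \<Longrightarrow> h differentiable (at x)"
    and y_escort: "escort_variable \<alpha> xi xf f h y"
    and abs_cont: "abs_continuous_real (rel_escort \<alpha> xi xf f h y)"
begin

text \<open>The relative escort density in the old variable, \<open>V x = \<rho> (y x)\<close>.\<close>

definition V where "V x = (f x / h x) powr \<alpha>"

text \<open>Written with the logarithmic derivative that occurs in \<open>rel_fisher\<close>;
  \<open>V_deriv\<close> identifies it as the derivative of \<open>V\<close>.\<close>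

definition V' where "V' x = \<alpha> * V x * deriv (\<lambda>t. ln (f t / h t)) x"

lemma Icc_subset:
  assumes "a \<in> \<Omega>" "b \<in> \<Omega>" shows "{a..b} \<subseteq> \<Omega>"
proof
  fix z assume "z \<in> {a..b}"
  then show "z \<in> \<Omega>"
    using assms less_le_trans[of xi "ereal a" "ereal z"] le_less_trans[of "ereal z" "ereal b" xf]
    by (simp add: \<Omega>_def einterval_iff)
qed

lemma open_\<Omega>: "open \<Omega>"
  by (simp add: \<Omega>_def)

lemma greater_exists:
  assumes "x \<in> \<Omega>" shows "\<exists>z\<in>\<Omega>. x < z"
proof -
  obtain z where "ereal x < ereal z" "ereal z < xf"
    using assms ereal_dense2[of "ereal x" xf] by (auto simp: \<Omega>_def einterval_iff)
  then show ?thesis using assms less_trans[of xi "ereal x" "ereal z"]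
    by (intro bexI[of _ z]) (simp_all add: \<Omega>_def einterval_iff)
qed

lemma less_exists:
  assumes "x \<in> \<Omega>" shows "\<exists>z\<in>\<Omega>. z < x"
proof -
  obtain z where "xi < ereal z" "ereal z < ereal x"
    using assms ereal_dense2[of xi "ereal x"] by (auto simp: \<Omega>_def einterval_iff)
  then show ?thesis using assms less_trans[of "ereal z" "ereal x" xf]
    by (intro bexI[of _ z]) (simp_all add: \<Omega>_def einterval_iff)
qed

lemma V_meas[measurable]: "V \<in> borel_measurable borel"
  unfolding V_def[abs_def] by measurable

lemma V_pos: "x \<in> \<Omega> \<Longrightarrow> V x > 0"
  using f_pos[of x] h_pos[of x] by (simp add: V_def)

text \<open>The identity \<open>f dx = \<rho> dy\<close> in the old variable.\<close>

lemma f_eq: "x \<in> \<Omega> \<Longrightarrow> f x = V x * k x"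
  using f_pos[of x] h_pos[of x] by (simp add: V_def k_def powr_divide powr_diff)

lemma V_deriv: "x \<in> \<Omega> \<Longrightarrow> (V has_real_derivative V' x) (at x)"
proof -
  assume x: "x \<in> \<Omega>"
  have "(\<lambda>t. ln (f t / h t)) differentiable (at x)"
  proof -
    obtain a b where "(f has_real_derivative a) (at x)" "(h has_real_derivative b) (at x)"
      using f_diff[OF x] h_diff[OF x] by (auto simp: real_differentiable_def)
    then have d: "((\<lambda>t. f t / h t) has_real_derivative (a * h x - f x * b) / (h x * h x)) (at x)"
      using h_pos[OF x] by (intro DERIV_divide) auto
    have "f x / h x > 0" using f_pos[OF x] h_pos[OF x] by simp
    from DERIV_chain2[where g = "\<lambda>t. f t / h t", OF DERIV_ln_divide[OF this] d]
    show ?thesis by (auto simp: real_differentiable_def)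
  qed
  then have "((\<lambda>t. ln (f t / h t)) has_real_derivative deriv (\<lambda>t. ln (f t / h t)) x) (at x)"
    by (metis DERIV_imp_deriv real_differentiable_def)
  then have "((\<lambda>t. exp (\<alpha> * ln (f t / h t))) has_real_derivative
      exp (\<alpha> * ln (f x / h x)) * (\<alpha> * deriv (\<lambda>t. ln (f t / h t)) x)) (at x)"
    by (intro DERIV_fun_exp DERIV_cmult)
  moreover have e: "exp (\<alpha> * ln (f t / h t)) = V t" if "t \<in> \<Omega>" for t
    using f_pos[OF that] h_pos[OF that] by (simp add: V_def powr_def)
  ultimately have "((\<lambda>t. exp (\<alpha> * ln (f t / h t))) has_real_derivative V' x) (at x)"
    using e[OF x] by (simp add: V'_def mult_ac)
  then show ?thesis
    by (rule has_field_derivative_transform_within_open[OF _ open_\<Omega> x e])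
qed

lemma V'_meas[measurable]: "(\<lambda>x. indicator \<Omega> x * V' x) \<in> borel_measurable borel"
  by (rule borel_measurable_indicator_derivative[OF _ _ V_deriv]) auto

lemma y_deriv: "x \<in> \<Omega> \<Longrightarrow> (y has_real_derivative k x) (at x)"
  using y_escort by (auto simp: escort_variable_def \<Omega>_def k_def)

lemma y_less: "a \<in> \<Omega> \<Longrightarrow> b \<in> \<Omega> \<Longrightarrow> a < b \<Longrightarrow> y a < y b"
proof (erule DERIV_pos_imp_increasing)
  fix z assume "a \<in> \<Omega>" "b \<in> \<Omega>" "a \<le> z" "z \<le> b"
  then have "z \<in> \<Omega>" using Icc_subset[of a b] by auto
  then show "\<exists>D. (y has_real_derivative D) (at z) \<and> 0 < D" using y_deriv k_pos by blast
qed

lemma y_less_iff: "a \<in> \<Omega> \<Longrightarrow> b \<in> \<Omega> \<Longrightarrow> y a < y b \<longleftrightarrow> a < b"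
  using y_less[of a b] y_less[of b a] by (cases a b rule: linorder_cases) auto

abbreviation "\<rho> \<equiv> rel_escort \<alpha> xi xf f h y"

lemma \<rho>_y: "x \<in> \<Omega> \<Longrightarrow> \<rho> (y x) = V x"
proof -
  assume x: "x \<in> \<Omega>"
  have "inj_on y \<Omega>"
  proof (rule inj_onI)
    show "a = b" if "a \<in> \<Omega>" "b \<in> \<Omega>" "y a = y b" for a b
      using that y_less[of a b] y_less[of b a] by (cases a b rule: linorder_cases) auto
  qed
  then show ?thesis using x by (simp add: rel_escort_def V_def \<Omega>_def)
qed

lemma \<rho>_outside: "u \<notin> y ` \<Omega> \<Longrightarrow> \<rho> u = 0"
  by (simp add: rel_escort_def \<Omega>_def)

text \<open>Uniform continuity is the one-interval case \<open>n = 1\<close> of the definition, and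
  absolute continuity enters in this form.\<close>

lemma \<rho>_unif:
  assumes "e > 0"
  obtains d where "d > 0" "\<And>u v. \<bar>u - v\<bar> < d \<Longrightarrow> \<bar>\<rho> u - \<rho> v\<bar> < e"
proof -
  obtain d where d: "d > 0" and
    *: "\<And>(n::nat) a b. (\<forall>i<n. a i \<le> b i) \<Longrightarrow> disjoint_family_on (\<lambda>i. {a i<..<b i}) {..<n} \<Longrightarrow>
        (\<Sum>i<n. b i - a i) < d \<Longrightarrow> (\<Sum>i<n. \<bar>\<rho> (b i) - \<rho> (a i)\<bar>) < e"
    using abs_cont assms unfolding abs_continuous_real_def by meson
  have 1: "\<bar>\<rho> v - \<rho> u\<bar> < e" if "u \<le> v" "v - u < d" for u v
    using *[of 1 "\<lambda>_. u" "\<lambda>_. v"] that by (simp add: disjoint_family_on_def)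
  have "\<bar>\<rho> u - \<rho> v\<bar> < e" if "\<bar>u - v\<bar> < d" for u v
    using 1[of u v] 1[of v u] that by (cases "u \<le> v") (auto simp: abs_minus_commute)
  then show thesis using that d by blast
qed

text \<open>Chebyshev's bound: a height of at least \<open>e\<close> over a stretch of
  \<open>y\<close>-length \<open>l\<close> carries mass at least \<open>e l\<close>, and the total
  mass is one.\<close>

lemma y_increment_le:
  assumes ab: "a \<in> \<Omega>" "b \<in> \<Omega>" "a \<le> b" and e: "e \<ge> 0" and V: "\<And>x. x \<in> {a..b} \<Longrightarrow> e \<le> V x"
  shows "e * (y b - y a) \<le> 1"
proof -
  note sub = Icc_subset[OF ab(1,2)]
  have "ennreal (e * (y b - y a)) = ennreal e * (\<integral>\<^sup>+x\<in>{a..b}. ennreal (k x) \<partial>lborel)"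
    using y_deriv sub k_pos e by (subst nn_integral_derivative_Icc[OF ab(3)]) (auto simp: ennreal_mult' less_imp_le)
  also have "\<dots> = (\<integral>\<^sup>+x. ennreal e * (ennreal (k x) * indicator {a..b} x) \<partial>lborel)"
    by (rule nn_integral_cmult[symmetric]) measurable
  also have "\<dots> \<le> (\<integral>\<^sup>+x\<in>\<Omega>. ennreal (f x) \<partial>lborel)"
  proof (intro nn_integral_mono)
    fix x
    have "ennreal e * ennreal (k x) \<le> ennreal (f x)" if "x \<in> {a..b}"
    proof -
      have "x \<in> \<Omega>" using that sub by auto
      then show ?thesis
        using V[OF that] e k_pos[of x] by (auto simp: f_eq ennreal_mult'[symmetric] intro!: ennreal_leI mult_right_mono)
    qed
    then show "ennreal e * (ennreal (k x) * indicator {a..b} x) \<le> ennreal (f x) * indicator \<Omega> x"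
      using sub by (auto simp: indicator_def)
  qed
  finally show ?thesis using int_f by simp
qed

text \<open>By uniform continuity a very high value of \<open>\<rho>\<close> persists over a stretch
  of fixed length, and the mass there would exceed one.\<close>

lemma V_bounded: "\<exists>B. \<forall>x\<in>\<Omega>. V x \<le> B"
proof -
  obtain d where d: "d > 0" "\<And>u v. \<bar>u - v\<bar> < d \<Longrightarrow> \<bar>\<rho> u - \<rho> v\<bar> < 1" using \<rho>_unif[of 1] by auto
  have "V x \<le> 1 + 3 / d" if x: "x \<in> \<Omega>" for x
  proof (rule ccontr)
    assume big: "\<not> V x \<le> 1 + 3 / d"
    \<comment> \<open>The summand \<open>1\<close> absorbs the oscillation of \<open>\<rho>\<close>;
      height \<open>3 / d\<close> over length \<open>d / 2\<close> gives mass
      \<open>3 / 2\<close>.\<close>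
    have near: "3 / d < \<rho> u" if "y x \<le> u" "u \<le> y x + d / 2" for u
      using d(2)[of u "y x"] that big \<rho>_y[OF x] d(1) by (auto simp: abs_if split: if_splits)
    \<comment> \<open>Positivity of \<open>\<rho>\<close> puts the right end of the stretch in the
      range of \<open>y\<close>, so the stretch comes from an interval in
      \<open>\<Omega>\<close>.\<close>
    have "\<rho> (y x + d / 2) > 0" using near[of "y x + d / 2"] d(1) less_trans[of 0 "3 / d"] by simp
    then obtain z where z: "z \<in> \<Omega>" "y z = y x + d / 2"
      using \<rho>_outside by (metis imageE less_irrefl)
    have xz: "x < z" using y_less_iff[OF x z(1)] z(2) d(1) by simp
    have "3 / d * (y z - y x) \<le> 1"
    proof (rule y_increment_le[OF x z(1)])
      fix w assume w: "w \<in> {x..z}"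
      then have "w \<in> \<Omega>" using Icc_subset[OF x z(1)] by auto
      then show "3 / d \<le> V w"
        using near[of "y w"] w z \<rho>_y y_less_iff[of w x] y_less_iff[of z w] x by (force simp: not_less[symmetric])
    qed (use xz d in auto)
    then show False using z(2) d(1) by simp
  qed
  then show ?thesis by blast
qed

text \<open>If \<open>V\<close> stayed above \<open>e\<close>, Chebyshev's bound would keep
  \<open>y\<close> bounded to the right. At the supremum of its values \<open>\<rho>\<close> is
  zero, while \<open>\<rho> \<ge> e\<close> arbitrarily close to it, against continuity.\<close>

lemma V_small_right:
  assumes x: "x \<in> \<Omega>" and e: "e > 0"
  shows "\<exists>b\<in>\<Omega>. x \<le> b \<and> V b < e"
proof (rule ccontr)
  assume "\<not> ?thesis"
  then have big: "e \<le> V b" if "b \<in> \<Omega>" "x \<le> b" for b using that by fastforce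
  define B where "B = y ` {b \<in> \<Omega>. x \<le> b}"
  have ne: "B \<noteq> {}" using x by (auto simp: B_def)
  have bdd: "bdd_above B"
  proof (rule bdd_aboveI)
    fix u assume "u \<in> B"
    then obtain b where b: "b \<in> \<Omega>" "x \<le> b" "u = y b" by (auto simp: B_def)
    have "e * (y b - y x) \<le> 1"
      using b x e big Icc_subset[OF x b(1)] by (intro y_increment_le) auto
    then have "y b - y x \<le> 1 / e" using e by (simp add: field_simps)
    then show "u \<le> y x + 1 / e" using b by simp
  qed
  \<comment> \<open>\<open>\<Omega>\<close> has no last point and \<open>y\<close> is strictly
    increasing, so the supremum is not a value of \<open>y\<close>.\<close>
  have "Sup B \<notin> y ` \<Omega>"
  proof
    assume "Sup B \<in> y ` \<Omega>"
    then obtain s where s: "s \<in> \<Omega>" "y s = Sup B" by auto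
    obtain z where z: "z \<in> \<Omega>" "s < z" using greater_exists s by blast
    have "y x \<le> y s" unfolding s using bdd x by (intro cSup_upper) (auto simp: B_def)
    then have "x \<le> s" using y_less_iff[OF s(1) x] by linarith
    then have "y z \<le> Sup B" using bdd z by (intro cSup_upper) (auto simp: B_def)
    then show False using y_less[OF s(1) z(1)] z s by simp
  qed
  then have 0: "\<rho> (Sup B) = 0" by (rule \<rho>_outside)
  obtain d where d: "d > 0" "\<And>u v. \<bar>u - v\<bar> < d \<Longrightarrow> \<bar>\<rho> u - \<rho> v\<bar> < e" using \<rho>_unif[OF e] by auto
  obtain u where u: "u \<in> B" "Sup B - d < u" using less_cSup_iff[OF ne bdd, of "Sup B - d"] d by auto
  have "u \<le> Sup B" using u bdd by (intro cSup_upper)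
  then have "\<bar>\<rho> u\<bar> < e" using d(2)[of u "Sup B"] u 0 by simp
  then show False using u(1) big \<rho>_y by (auto simp: B_def) (metis abs_ge_self leD le_less_trans)
qed

text \<open>The mirror image of the previous argument, with the infimum of the values of
  \<open>y\<close>.\<close>

lemma V_small_left:
  assumes x: "x \<in> \<Omega>" and e: "e > 0"
  shows "\<exists>b\<in>\<Omega>. b \<le> x \<and> V b < e"
proof (rule ccontr)
  assume "\<not> ?thesis"
  then have big: "e \<le> V b" if "b \<in> \<Omega>" "b \<le> x" for b using that by fastforce
  define B where "B = y ` {b \<in> \<Omega>. b \<le> x}"
  have ne: "B \<noteq> {}" using x by (auto simp: B_def)
  have bdd: "bdd_below B"
  proof (rule bdd_belowI)
    fix u assume "u \<in> B"
    then obtain b where b: "b \<in> \<Omega>" "b \<le> x" "u = y b" by (auto simp: B_def)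
    have "e * (y x - y b) \<le> 1"
      using b x e big Icc_subset[OF b(1) x] by (intro y_increment_le) auto
    then have "y x - y b \<le> 1 / e" using e by (simp add: field_simps)
    then show "y x - 1 / e \<le> u" using b by simp
  qed
  have "Inf B \<notin> y ` \<Omega>"
  proof
    assume "Inf B \<in> y ` \<Omega>"
    then obtain s where s: "s \<in> \<Omega>" "y s = Inf B" by auto
    obtain z where z: "z \<in> \<Omega>" "z < s" using less_exists s by blast
    have "y s \<le> y x" unfolding s using bdd x by (intro cInf_lower) (auto simp: B_def)
    then have "s \<le> x" using y_less_iff[OF x s(1)] by linarith
    then have "Inf B \<le> y z" using bdd z by (intro cInf_lower) (auto simp: B_def)
    then show False using y_less[OF z(1) s(1)] z s by simp
  qed
  then have 0: "\<rho> (Inf B) = 0" by (rule \<rho>_outside)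
  obtain d where d: "d > 0" "\<And>u v. \<bar>u - v\<bar> < d \<Longrightarrow> \<bar>\<rho> u - \<rho> v\<bar> < e" using \<rho>_unif[OF e] by auto
  obtain u where u: "u \<in> B" "u < Inf B + d" using cInf_less_iff[OF ne bdd, of "Inf B + d"] d by auto
  have "Inf B \<le> u" using u bdd by (intro cInf_lower)
  then have "\<bar>\<rho> u\<bar> < e" using d(2)[of u "Inf B"] u 0 by simp
  then show False using u(1) big \<rho>_y by (auto simp: B_def) (metis abs_ge_self leD le_less_trans)
qed

lemma V_diff_le:
  assumes "a \<in> \<Omega>" "b \<in> \<Omega>" "a \<le> b"
  shows "ennreal \<bar>V b - V a\<bar> \<le> (\<integral>\<^sup>+s\<in>{a..b}. ennreal \<bar>V' s\<bar> \<partial>lborel)"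
proof -
  note sub = Icc_subset[OF assms(1,2)]
  have "(\<lambda>x. indicator {a..b} x * (indicator \<Omega> x * V' x)) \<in> borel_measurable borel" by measurable
  also have "(\<lambda>x. indicator {a..b} x * (indicator \<Omega> x * V' x)) = (\<lambda>x. indicator {a..b} x * V' x)"
    using sub by (auto simp: indicator_def fun_eq_iff)
  finally show ?thesis
    using sub by (intro abs_diff_le_nn_integral_derivative[OF assms(3)] V_deriv) auto
qed

text \<open>No absolute continuity is needed here: \<open>V\<close> is differentiable everywhere, so the
  fundamental theorem of calculus holds as soon as \<open>V'\<close> is integrable, and otherwise the right-hand
  side is infinite.\<close>

lemma V_le_tail:
  assumes x: "x \<in> \<Omega>" and S: "{s \<in> \<Omega>. x \<le> s} \<subseteq> S \<or> {s \<in> \<Omega>. s \<le> x} \<subseteq> S"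
  shows "ennreal (V x) \<le> (\<integral>\<^sup>+s. ennreal \<bar>V' s\<bar> * indicator S s * indicator \<Omega> s \<partial>lborel)" (is "_ \<le> ?I")
proof (rule ennreal_le_epsilon)
  fix e :: real assume e: "0 < e"
  \<comment> \<open>The interval joins \<open>x\<close> to a point on the side covered by
    \<open>S\<close> where \<open>V < e\<close>, so \<open>V x\<close> differs from the increment by
    at most \<open>e\<close>.\<close>
  obtain a b where ab: "a \<in> \<Omega>" "b \<in> \<Omega>" "a \<le> b" "{a..b} \<subseteq> S" "V x \<le> \<bar>V b - V a\<bar> + e"
    using S
  proof
    assume S: "{s \<in> \<Omega>. x \<le> s} \<subseteq> S"
    obtain b where b: "b \<in> \<Omega>" "x \<le> b" "V b < e" using V_small_right[OF x e] by auto
    then show thesis using that[of x b] x S Icc_subset[OF x b(1)] by fastforce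
  next
    assume S: "{s \<in> \<Omega>. s \<le> x} \<subseteq> S"
    obtain b where b: "b \<in> \<Omega>" "b \<le> x" "V b < e" using V_small_left[OF x e] by auto
    then show thesis using that[of b x] x S Icc_subset[OF b(1) x] by fastforce
  qed
  have "ennreal (V x) \<le> ennreal \<bar>V b - V a\<bar> + ennreal e"
    using ab(5) e by (simp flip: ennreal_plus)
  also have "ennreal \<bar>V b - V a\<bar> \<le> (\<integral>\<^sup>+s\<in>{a..b}. ennreal \<bar>V' s\<bar> \<partial>lborel)" by (rule V_diff_le[OF ab(1-3)])
  also have "\<dots> \<le> ?I"
    using ab(4) Icc_subset[OF ab(1,2)] by (intro nn_integral_mono) (auto simp: indicator_def)
  finally show "ennreal (V x) \<le> ?I + ennreal e" by (simp add: add_right_mono)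
qed

text \<open>Since \<open>0 * \<infinity> = 0\<close> in \<^typ>\<open>ennreal\<close>, the Fisher inequality would be false if the divergence
  were infinite.\<close>

lemma KL_finite: "(\<integral>\<^sup>+x\<in>\<Omega>. ennreal (f x * ln (f x / h x)) \<partial>lborel) \<noteq> \<infinity>"
proof -
  \<comment> \<open>A bound on \<open>V\<close> bounds \<open>ln (f / h) = ln V / \<alpha>\<close>
    from above.\<close>
  obtain B where B: "\<And>x. x \<in> \<Omega> \<Longrightarrow> V x \<le> B" using V_bounded by blast
  have "(\<integral>\<^sup>+x\<in>\<Omega>. ennreal (f x * ln (f x / h x)) \<partial>lborel)
      \<le> (\<integral>\<^sup>+x. ennreal (\<bar>B\<bar> / \<alpha>) * (ennreal (f x) * indicator \<Omega> x) \<partial>lborel)"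
  proof (intro nn_integral_mono)
    fix x
    have "f x * ln (f x / h x) \<le> \<bar>B\<bar> / \<alpha> * f x" if x: "x \<in> \<Omega>"
    proof -
      have "\<alpha> * ln (f x / h x) = ln (V x)" using f_pos[OF x] h_pos[OF x] by (simp add: V_def ln_powr)
      also have "\<dots> \<le> \<bar>B\<bar>" using ln_le_minus_one[OF V_pos[OF x]] B[OF x] by linarith
      finally have "ln (f x / h x) \<le> \<bar>B\<bar> / \<alpha>" using \<alpha>_pos by (simp add: field_simps)
      then have "f x * ln (f x / h x) \<le> f x * (\<bar>B\<bar> / \<alpha>)" using f_pos[OF x] by (intro mult_left_mono) auto
      then show ?thesis by (simp add: mult.commute)
    qed
    then show "ennreal (f x * ln (f x / h x)) * indicator \<Omega> x
        \<le> ennreal (\<bar>B\<bar> / \<alpha>) * (ennreal (f x) * indicator \<Omega> x)"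
      using \<alpha>_pos f_pos[of x] by (auto simp: indicator_def ennreal_mult'[symmetric] intro!: ennreal_leI)
  qed
  also have "\<dots> = ennreal (\<bar>B\<bar> / \<alpha>)" by (subst nn_integral_cmult) (auto simp: int_f)
  finally show ?thesis by (auto simp: top_unique)
qed

end

section \<open>Transport and the Fisher-entropy inequality\<close>

text \<open>Monotone rearrangement: \<open>T\<close> is the Gaussian quantile function composed with
  the distribution function \<open>F\<close> of \<open>f\<close>, and the chain rule gives its
  derivative.\<close>

lemma (in density_pair) transport_exists:
  fixes q :: real and g :: "real \<Rightarrow> real"
  assumes q: "q > 0" and f_cont: "continuous_on \<Omega> f"
  defines "g \<equiv> \<lambda>x. exp (- (\<bar>x\<bar> powr q)) / gg_const q"
  obtains T where "\<And>x. x \<in> \<Omega> \<Longrightarrow> (T has_real_derivative f x / g (T x)) (at x)" "T ` \<Omega> = UNIV"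
proof -
  let ?f = "\<lambda>x. indicator \<Omega> x * f x"
  interpret F: lborel_density ?f
  proof
    show "0 \<le> ?f x" for x using f_pos[of x] by (simp add: indicator_def less_imp_le)
    have "(\<integral>\<^sup>+x. ennreal (?f x) \<partial>lborel) = (\<integral>\<^sup>+x\<in>\<Omega>. ennreal (f x) \<partial>lborel)"
      by (intro nn_integral_cong) (simp add: indicator_def)
    then show "(\<integral>\<^sup>+x. ennreal (?f x) \<partial>lborel) = 1" using int_f by simp
  qed measurable
  define F where "F = cdf F.M"
  have dF: "(F has_real_derivative f x) (at x)" if x: "x \<in> \<Omega>" for x
  proof -
    have "continuous_on \<Omega> ?f" using f_cont by (rule continuous_on_eq) (simp add: indicator_def)
    then have "(F has_real_derivative ?f x) (at x)"
      unfolding F_def using x by (intro F.cdf_deriv[of \<Omega>]) (simp_all add: \<Omega>_def)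
    then show ?thesis using x by simp
  qed
  have F_less: "F a < F b" if "a < b" "{a..b} \<subseteq> \<Omega>" for a b
    using that(1)
  proof (rule DERIV_pos_imp_increasing)
    show "\<exists>D. (F has_real_derivative D) (at z) \<and> 0 < D" if "a \<le> z" "z \<le> b" for z
      using dF[of z] f_pos[of z] that \<open>{a..b} \<subseteq> \<Omega>\<close> by (intro exI[of _ "f z"]) auto
  qed
  \<comment> \<open>The strict bounds keep \<open>F x\<close> in the open interval where the
    quantile function is differentiable.\<close>
  have F_range: "0 < F x" "F x < 1" if x: "x \<in> \<Omega>" for x
  proof -
    obtain e where e: "e > 0" "cball x e \<subseteq> \<Omega>"
      using x open_contains_cball[of \<Omega>] by (auto simp: \<Omega>_def)
    then have "{x - e..x} \<subseteq> \<Omega>" "{x..x + e} \<subseteq> \<Omega>" by (auto simp: cball_eq_atLeastAtMost)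
    then have "F (x - e) < F x" "F x < F (x + e)" using F_less e by auto
    moreover have "0 \<le> F (x - e)" "F (x + e) \<le> 1"
      unfolding F_def by (rule F.cdf_nonneg, rule F.cdf_bounded_prob)
    ultimately show "0 < F x" "F x < 1" by linarith+
  qed
  \<comment> \<open>Needed for surjectivity: a point with \<open>F x\<close> strictly between
    \<open>0\<close> and \<open>1\<close> must lie in \<open>\<Omega>\<close>.\<close>
  have F_outside: "F x = 0 \<or> F x = 1" if x: "x \<notin> \<Omega>" for x
  proof -
    have "ereal x \<le> xi \<or> xf \<le> ereal x" using x by (auto simp: \<Omega>_def einterval_iff not_less)
    then show ?thesis
    proof
      assume le: "ereal x \<le> xi"
      have "emeasure F.M {..x} = (\<integral>\<^sup>+t\<in>{..x}. ennreal (?f t) \<partial>lborel)" by (simp add: emeasure_density)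
      also have "\<dots> = (\<integral>\<^sup>+t. 0 \<partial>(lborel :: real measure))"
      proof (intro nn_integral_cong)
        fix t
        have "t \<notin> \<Omega>" if "t \<le> x"
          using order_trans[of "ereal t" "ereal x" xi] that le by (auto simp: \<Omega>_def einterval_iff not_less)
        then show "ennreal (?f t) * indicator {..x} t = 0" by (auto simp: indicator_def)
      qed
      finally show ?thesis by (simp add: F_def cdf_def measure_def)
    next
      assume le: "xf \<le> ereal x"
      have "emeasure F.M {..x} = (\<integral>\<^sup>+t\<in>{..x}. ennreal (?f t) \<partial>lborel)" by (simp add: emeasure_density)
      also have "\<dots> = (\<integral>\<^sup>+t\<in>\<Omega>. ennreal (f t) \<partial>lborel)"
      proof (intro nn_integral_cong)
        fix t
        have "t \<le> x" if "t \<in> \<Omega>"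
          using order_trans[of "ereal t" xf "ereal x"] that le by (auto simp: \<Omega>_def einterval_iff)
        then show "ennreal (?f t) * indicator {..x} t = ennreal (f t) * indicator \<Omega> t" by (auto simp: indicator_def)
      qed
      finally show ?thesis using int_f by (simp add: F_def cdf_def measure_def)
    qed
  qed
  define G where "G = cdf (density lborel (\<lambda>x. ennreal (g x)))"
  obtain H where H: "\<forall>t. H (G t) = t"
    "\<forall>u. 0 < u \<longrightarrow> u < 1 \<longrightarrow> G (H u) = u \<and> (H has_real_derivative 1 / g (H u)) (at u)"
    using gauss_cdf_inv[OF q] unfolding G_def g_def by blast
  have "((\<lambda>x. H (F x)) has_real_derivative f x / g (H (F x))) (at x)" if x: "x \<in> \<Omega>" for x
  proof -
    have "(H has_real_derivative 1 / g (H (F x))) (at (F x))" using H(2) F_range[OF x] by blast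
    from DERIV_chain2[OF this dF[OF x]] show ?thesis by simp
  qed
  moreover have "(\<lambda>x. H (F x)) ` \<Omega> = UNIV"
  proof -
    have "t \<in> (\<lambda>x. H (F x)) ` \<Omega>" for t
    proof -
      have G: "0 < G t" "G t < 1" using gauss_cdf_range[OF q] by (auto simp: G_def g_def)
      then obtain x where x: "F x = G t" using F.cdf_surj[of "G t"] by (auto simp: F_def)
      then have "x \<in> \<Omega>" using F_outside[of x] G by auto
      then show ?thesis using x H(1) by (intro image_eqI[of _ _ x]) simp_all
    qed
    then show ?thesis by auto
  qed
  ultimately show thesis by (rule that)
qed

text \<open>In the variable \<open>y\<close> the derivative of \<open>\<rho>\<close> is
  \<open>V' / k\<close>, so \<open>\<alpha> I^(1/p)\<close> is the classical Fisher functional of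
  \<open>\<rho>\<close> and the claim is the Fisher-entropy inequality for it.\<close>

lemma (in escort_pair) fisher_entropy_finite:
  fixes p q I :: real
  assumes p: "p > 1" and q_def: "q = p / (p - 1)"
    and I: "(\<integral>\<^sup>+x\<in>\<Omega>. ennreal (f x * (\<bar>V' x\<bar> / (\<alpha> * f x)) powr p) \<partial>lborel) = ennreal I" and I0: "I \<ge> 0"
  shows "gg_bound q \<le> \<alpha> * I powr (1 / p) * exp (- (\<alpha> * rel_ent))"
proof -
  have q: "q > 1" and pq: "1 / q + 1 / p = 1" using p unfolding q_def by (auto simp: field_simps)
  then have q0: "q > 0" by simp
  let ?Z = "gg_const q"
  have Z: "?Z > 0" using gg_const_pos q0 by simp
  define g where "g x = exp (- (\<bar>x\<bar> powr q)) / ?Z" for x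
  have g_pos: "g x > 0" for x using Z by (simp add: g_def)
  have f_cont: "continuous_on \<Omega> f"
    using f_diff by (meson continuous_at_imp_continuous_on differentiable_imp_continuous_within)
  obtain T where T: "\<And>x. x \<in> \<Omega> \<Longrightarrow> (T has_real_derivative f x / g (T x)) (at x)" "T ` \<Omega> = UNIV"
    using transport_exists[OF q0 f_cont] unfolding g_def by metis
  define T' where "T' x = f x / g (T x)" for x
  have T'_pos: "x \<in> \<Omega> \<Longrightarrow> T' x > 0" for x using f_pos g_pos by (simp add: T'_def)
  note dT = T(1)[folded T'_def]
  have T_cont: "continuous_on \<Omega> T" using dT by (meson DERIV_continuous_on has_field_derivative_at_within)
  have T'_cont: "continuous_on \<Omega> T'"
    unfolding T'_def[abs_def] g_def
    using f_cont T_cont Z q0 by (intro continuous_intros continuous_on_powr') (auto)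
  have [measurable]: "(\<lambda>x. indicator \<Omega> x * T x) \<in> borel_measurable borel"
    "(\<lambda>x. indicator \<Omega> x * T' x) \<in> borel_measurable borel"
    using borel_measurable_continuous_on_indicator[of \<Omega> T] borel_measurable_continuous_on_indicator[of \<Omega> T']
      T_cont T'_cont by auto
  \<comment> \<open>The substitution \<open>v = T x\<close> turns this into the \<open>q\<close>-th
    moment of the Gaussian.\<close>
  have mT: "(\<integral>\<^sup>+x\<in>\<Omega>. ennreal (f x * \<bar>T x\<bar> powr q) \<partial>lborel) = ennreal (1 / q)"
  proof -
    have "(\<integral>\<^sup>+x\<in>\<Omega>. ennreal (f x * \<bar>T x\<bar> powr q) \<partial>lborel)
      = (\<integral>\<^sup>+x\<in>\<Omega>. ennreal ((\<bar>T x\<bar> powr q * g (T x)) * T' x) \<partial>lborel)"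
      using g_pos by (intro nn_integral_cong) (simp add: T'_def less_imp_neq[symmetric] mult.commute)
    also have "\<dots> = (\<integral>\<^sup>+x\<in>T ` \<Omega>. ennreal (\<bar>x\<bar> powr q * g x) \<partial>lborel)"
      unfolding \<Omega>_def
      by (intro nn_integral_substitution_einterval[OF xi_xf])
        (use dT T'_pos T'_cont in \<open>auto simp: \<Omega>_def[symmetric] g_def less_imp_le\<close>)
    also have "\<dots> = (\<integral>\<^sup>+x. ennreal (\<bar>x\<bar> powr q * exp (- (\<bar>x\<bar> powr q)) / ?Z) \<partial>lborel)" by (simp add: T g_def)
    also have "\<dots> = ennreal (\<integral>x. \<bar>x\<bar> powr q * exp (- (\<bar>x\<bar> powr q)) / ?Z \<partial>lborel)"
      using gg_moment_integrable[OF q0] Z by (intro nn_integral_eq_integral) auto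
    also have "\<dots> = ennreal (1 / q)" using Z gg_moment[OF q0] by simp
    finally show ?thesis .
  qed
  \<comment> \<open>If \<open>I\<close> were zero, \<open>V'\<close> would vanish almost everywhere,
    and the tail bound would force \<open>V \<le> 0\<close>. Positivity permits the normalization by
    \<open>I\<close> below.\<close>
  have I_pos: "I > 0"
  proof (rule ccontr)
    assume "\<not> I > 0"
    then have "I = 0" using I0 by simp
    have "(\<integral>\<^sup>+x\<in>\<Omega>. ennreal (f x * (\<bar>indicator \<Omega> x * V' x\<bar> / (\<alpha> * f x)) powr p) \<partial>lborel) = ennreal I"
      unfolding I[symmetric] by (intro nn_integral_cong) (simp add: indicator_def)
    then have "(\<integral>\<^sup>+x\<in>\<Omega>. ennreal (f x * (\<bar>indicator \<Omega> x * V' x\<bar> / (\<alpha> * f x)) powr p) \<partial>lborel) = 0"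
      using \<open>I = 0\<close> by simp
    then have "AE x in lborel. ennreal (f x * (\<bar>indicator \<Omega> x * V' x\<bar> / (\<alpha> * f x)) powr p) * indicator \<Omega> x = 0"
      by (subst (asm) nn_integral_0_iff_AE) auto
    then have "AE x in lborel. ennreal \<bar>V' x\<bar> * indicator UNIV x * indicator \<Omega> x = 0"
    proof eventually_elim
      case (elim x)
      then show ?case using f_pos[of x] \<alpha>_pos by (auto simp: indicator_def ennreal_eq_0_iff mult_le_0_iff)
    qed
    then have 0: "(\<integral>\<^sup>+x. ennreal \<bar>V' x\<bar> * indicator UNIV x * indicator \<Omega> x \<partial>lborel) = (\<integral>\<^sup>+x. 0 \<partial>(lborel :: real measure))"
      by (rule nn_integral_cong_AE)
    obtain x where x: "x \<in> \<Omega>" using einterval_nonempty[OF xi_xf] by (auto simp: \<Omega>_def)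
    have "ennreal (V x) \<le> 0" using V_le_tail[OF x, of UNIV] 0 by simp
    then show False using V_pos[OF x] by (simp add: ennreal_eq_0_iff)
  qed
  \<comment> \<open>\<open>\<Phi>\<close> is the Fisher functional of \<open>\<rho>\<close> and
    \<open>\<sigma>\<close> the moment deviation of the Gaussian; their product is the Hoelder bound
    \<open>B\<close>.\<close>
  define \<Phi> where "\<Phi> = \<alpha> * I powr (1 / p)"
  define \<sigma> where "\<sigma> = (1 / q) powr (1 / q)"
  have \<Phi>: "\<Phi> > 0" and \<sigma>: "\<sigma> > 0" using \<alpha>_pos I_pos q0 by (auto simp: \<Phi>_def \<sigma>_def)
  define B where "B = \<sigma> * \<Phi>"
  have B: "B > 0" using \<Phi> \<sigma> by (simp add: B_def)
  have hoelder: "(\<integral>\<^sup>+x\<in>\<Omega>. ennreal (\<bar>T x\<bar> * \<bar>V' x\<bar>) \<partial>lborel) \<le> ennreal B"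
  proof -
    let ?A = "\<lambda>x. f x * \<bar>indicator \<Omega> x * T x\<bar> powr q" and ?C = "\<lambda>x. f x * (\<bar>indicator \<Omega> x * V' x\<bar> / (\<alpha> * f x)) powr p"
    have "(\<integral>\<^sup>+x\<in>\<Omega>. ennreal (\<bar>T x\<bar> * \<bar>V' x\<bar>) \<partial>lborel)
      \<le> (\<integral>\<^sup>+x. ennreal B * (ennreal (?A x) * indicator \<Omega> x) + ennreal (B / (p * I)) * (ennreal (?C x) * indicator \<Omega> x) \<partial>lborel)"
    proof (intro nn_integral_mono)
      fix x
      have "\<bar>T x\<bar> * \<bar>V' x\<bar> \<le> B * (f x * \<bar>T x\<bar> powr q) + B / (p * I) * (f x * (\<bar>V' x\<bar> / (\<alpha> * f x)) powr p)"
        if x: "x \<in> \<Omega>"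
      proof -
        \<comment> \<open>Hoelder from Young: after this scaling the \<open>q\<close>-th power of
          \<open>?a\<close> and the \<open>p\<close>-th power of \<open>?b\<close> both have mean
          one under \<open>f\<close>.\<close>
        let ?a = "\<bar>T x\<bar> / \<sigma>" and ?b = "\<bar>V' x\<bar> / (f x * \<Phi>)"
        have fx: "f x > 0" by (rule f_pos[OF x])
        have "?a powr q = q * \<bar>T x\<bar> powr q"
          using q0 by (simp add: \<sigma>_def powr_divide powr_powr powr_mult)
        moreover have "?b powr p = (\<bar>V' x\<bar> / (\<alpha> * f x)) powr p / I"
          using p I_pos \<alpha>_pos fx by (simp add: \<Phi>_def powr_divide powr_powr powr_mult field_simps)
        moreover have "?a * ?b \<le> ?a powr q / q + ?b powr p / p"
          using p q pq \<sigma> \<Phi> fx by (intro Youngs_inequality) auto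
        ultimately have "?a * ?b \<le> \<bar>T x\<bar> powr q + (\<bar>V' x\<bar> / (\<alpha> * f x)) powr p / I / p" using q0 by simp
        then have "f x * B * (?a * ?b) \<le> f x * B * (\<bar>T x\<bar> powr q + (\<bar>V' x\<bar> / (\<alpha> * f x)) powr p / I / p)"
          using fx B by (intro mult_left_mono) auto
        moreover have "f x * B * (?a * ?b) = \<bar>T x\<bar> * \<bar>V' x\<bar>"
          using fx \<sigma> \<Phi> by (simp add: B_def)
        ultimately show ?thesis by (simp add: algebra_simps)
      qed
      then show "ennreal (\<bar>T x\<bar> * \<bar>V' x\<bar>) * indicator \<Omega> x
        \<le> ennreal B * (ennreal (?A x) * indicator \<Omega> x) + ennreal (B / (p * I)) * (ennreal (?C x) * indicator \<Omega> x)"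
        using B p I_pos f_pos[of x]
        by (auto simp: indicator_def ennreal_mult'[symmetric] simp flip: ennreal_plus intro!: ennreal_leI)
    qed
    also have "\<dots> = ennreal B * (\<integral>\<^sup>+x\<in>\<Omega>. ennreal (?A x) \<partial>lborel) + ennreal (B / (p * I)) * (\<integral>\<^sup>+x\<in>\<Omega>. ennreal (?C x) \<partial>lborel)"
      by (subst nn_integral_add, simp, simp, subst nn_integral_cmult, simp, subst nn_integral_cmult, simp_all)
    also have "(\<integral>\<^sup>+x\<in>\<Omega>. ennreal (?A x) \<partial>lborel) = ennreal (1 / q)"
      unfolding mT[symmetric] by (intro nn_integral_cong) (simp add: indicator_def)
    also have "(\<integral>\<^sup>+x\<in>\<Omega>. ennreal (?C x) \<partial>lborel) = ennreal I"
      unfolding I[symmetric] by (intro nn_integral_cong) (simp add: indicator_def)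
    also have "ennreal B * ennreal (1 / q) + ennreal (B / (p * I)) * ennreal I = ennreal (B * (1 / q) + B / (p * I) * I)"
      using B q0 p I_pos by (simp flip: ennreal_mult' ennreal_plus)
    also have "B * (1 / q) + B / (p * I) * I = B * (1 / q + 1 / p)" using I_pos p by (simp add: field_simps)
    finally show ?thesis by (simp add: pq)
  qed
  obtain x0 where x0: "x0 \<in> \<Omega>" "T x0 = 0" using T(2) by (metis UNIV_I imageE)
  text \<open>Integration by parts as an application of Tonelli: bound \<open>V x\<close> by the integral of \<open>|V'|\<close>
    over the part of \<open>\<Omega>\<close> on the far side of \<open>x\<close> from the zero \<open>x0\<close> of \<open>T\<close>.\<close>
  define R where "R = {(x, s). (x0 \<le> x \<and> x \<le> s) \<or> (s \<le> x \<and> x \<le> x0)}"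
  have [measurable]: "R \<in> sets (borel \<Otimes>\<^sub>M borel)" 
  proof -
    have "R = {z \<in> space (borel \<Otimes>\<^sub>M borel). (x0 \<le> fst z \<and> fst z \<le> snd z) \<or> (snd z \<le> fst z \<and> fst z \<le> x0)}"
      by (auto simp: R_def space_pair_measure)
    also have "\<dots> \<in> sets (borel \<Otimes>\<^sub>M borel)" by measurable
    finally show ?thesis .
  qed
  have by_parts: "(\<integral>\<^sup>+x\<in>\<Omega>. ennreal (T' x * V x) \<partial>lborel) \<le> (\<integral>\<^sup>+x\<in>\<Omega>. ennreal (\<bar>T x\<bar> * \<bar>V' x\<bar>) \<partial>lborel)"
  proof -
    let ?W = "\<lambda>x s. ennreal (indicator \<Omega> x * T' x) * (ennreal \<bar>indicator \<Omega> s * V' s\<bar> * indicator R (x, s))"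
    have "(\<integral>\<^sup>+x\<in>\<Omega>. ennreal (T' x * V x) \<partial>lborel) \<le> (\<integral>\<^sup>+x. \<integral>\<^sup>+s. ?W x s \<partial>lborel \<partial>lborel)"
    proof (intro nn_integral_mono)
      fix x
      have "ennreal (T' x * V x) \<le> (\<integral>\<^sup>+s. ?W x s \<partial>lborel)" if x: "x \<in> \<Omega>"
      proof -
        have "{s \<in> \<Omega>. x \<le> s} \<subseteq> {s. (x, s) \<in> R} \<or> {s \<in> \<Omega>. s \<le> x} \<subseteq> {s. (x, s) \<in> R}"
          by (cases "x0 \<le> x") (auto simp: R_def)
        then have "ennreal (V x) \<le> (\<integral>\<^sup>+s. ennreal \<bar>V' s\<bar> * indicator {s. (x, s) \<in> R} s * indicator \<Omega> s \<partial>lborel)"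
          by (rule V_le_tail[OF x])
        also have "\<dots> = (\<integral>\<^sup>+s. ennreal \<bar>indicator \<Omega> s * V' s\<bar> * indicator R (x, s) \<partial>lborel)"
          by (intro nn_integral_cong) (auto simp: indicator_def)
        finally have "ennreal (T' x) * ennreal (V x)
          \<le> ennreal (T' x) * (\<integral>\<^sup>+s. ennreal \<bar>indicator \<Omega> s * V' s\<bar> * indicator R (x, s) \<partial>lborel)"
          by (intro mult_left_mono) auto
        also have "\<dots> = (\<integral>\<^sup>+s. ?W x s \<partial>lborel)"
          using x by (subst nn_integral_cmult) auto
        finally show ?thesis using T'_pos[OF x] by (simp add: ennreal_mult')
      qed
      then show "ennreal (T' x * V x) * indicator \<Omega> x \<le> (\<integral>\<^sup>+s. ?W x s \<partial>lborel)"
        by (auto simp: indicator_def)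
    qed
    also have "\<dots> = (\<integral>\<^sup>+s. \<integral>\<^sup>+x. ?W x s \<partial>lborel \<partial>lborel)"
      by (rule lborel_pair.Fubini'[symmetric]) measurable
    also have "\<dots> \<le> (\<integral>\<^sup>+x\<in>\<Omega>. ennreal (\<bar>T x\<bar> * \<bar>V' x\<bar>) \<partial>lborel)"
    proof (intro nn_integral_mono)
      fix s
      show "(\<integral>\<^sup>+x. ?W x s \<partial>lborel) \<le> ennreal (\<bar>T s\<bar> * \<bar>V' s\<bar>) * indicator \<Omega> s"
      proof (cases "s \<in> \<Omega>")
        case True
        \<comment> \<open>For fixed \<open>s\<close> the relation \<open>R\<close> leaves the
          \<open>x\<close> between \<open>x0\<close> and \<open>s\<close>, over which
          \<open>T'\<close> integrates to \<open>|T s - T x0| = |T s|\<close>.\<close>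
        define a b where "a = min s x0" and "b = max s x0"
        have ab: "a \<le> b" "{a..b} \<subseteq> \<Omega>" using Icc_subset[of a b] True x0 by (auto simp: a_def b_def min_def max_def)
        have "(\<integral>\<^sup>+x. ?W x s \<partial>lborel) \<le> (\<integral>\<^sup>+x. ennreal \<bar>V' s\<bar> * (ennreal (indicator \<Omega> x * T' x) * indicator {a..b} x) \<partial>lborel)"
          by (intro nn_integral_mono) (auto simp: indicator_def R_def a_def b_def mult_ac)
        also have "\<dots> = ennreal \<bar>V' s\<bar> * (\<integral>\<^sup>+x\<in>{a..b}. ennreal (indicator \<Omega> x * T' x) \<partial>lborel)"
          by (rule nn_integral_cmult) measurable
        also have "(\<integral>\<^sup>+x\<in>{a..b}. ennreal (indicator \<Omega> x * T' x) \<partial>lborel) = (\<integral>\<^sup>+x\<in>{a..b}. ennreal (T' x) \<partial>lborel)"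
          using ab by (intro nn_integral_cong) (auto simp: indicator_def)
        also have "\<dots> = ennreal (T b - T a)"
          using ab dT by (intro nn_integral_derivative_Icc) (auto intro!: less_imp_le[OF T'_pos])
        also have "ennreal \<bar>V' s\<bar> * ennreal (T b - T a) \<le> ennreal \<bar>V' s\<bar> * ennreal \<bar>T s\<bar>"
          using x0 by (intro mult_left_mono ennreal_leI) (auto simp: a_def b_def min_def max_def)
        also have "\<dots> = ennreal (\<bar>T s\<bar> * \<bar>V' s\<bar>) * indicator \<Omega> s"
          using True by (simp add: ennreal_mult' mult.commute)
        finally show ?thesis .
      qed simp
    qed
    finally show ?thesis .
  qed
  define J where "J x = indicator \<Omega> x * (T' x * V x)" for x
  have [measurable]: "J \<in> borel_measurable borel" unfolding J_def[abs_def] mult.assoc[symmetric] by measurable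
  have J_nonneg: "0 \<le> J x" for x using T'_pos[of x] V_pos[of x] by (cases "x \<in> \<Omega>") (simp_all add: J_def)
  have J_le: "(\<integral>\<^sup>+x. ennreal (J x) \<partial>lborel) \<le> ennreal B"
  proof -
    have "(\<integral>\<^sup>+x. ennreal (J x) \<partial>lborel) = (\<integral>\<^sup>+x\<in>\<Omega>. ennreal (T' x * V x) \<partial>lborel)"
      by (intro nn_integral_cong) (simp add: J_def indicator_def)
    then show ?thesis using by_parts hoelder by simp
  qed
  have J_int: "integrable lborel J"
    using J_le J_nonneg by (intro integrableI_nonneg) (auto intro: le_less_trans)
  have J_B: "(\<integral>x. J x \<partial>lborel) \<le> B"
    using J_le J_nonneg B by (subst integral_eq_nn_integral) (auto simp: enn2real_leI)
  let ?Tq = "\<lambda>x. indicator \<Omega> x * (f x * \<bar>indicator \<Omega> x * T x\<bar> powr q)"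
  have Tq: "integrable lborel ?Tq" "(\<integral>x. ?Tq x \<partial>lborel) = 1 / q"
  proof -
    have n: "0 \<le> ?Tq x" for x using f_pos[of x] by (cases "x \<in> \<Omega>") simp_all
    have e: "(\<integral>\<^sup>+x. ennreal (?Tq x) \<partial>lborel) = ennreal (1 / q)"
      unfolding mT[symmetric] by (intro nn_integral_cong) (simp add: indicator_def)
    show "integrable lborel ?Tq" using e n by (intro integrableI_nonneg) auto
    show "(\<integral>x. ?Tq x \<partial>lborel) = 1 / q" using e n q0 by (subst integral_eq_nn_integral) auto
  qed
  note KLi = KL_integrable[OF KL_finite]
  let ?R = "\<lambda>x. J x / B + (ln B - 1 - ln ?Z) * (indicator \<Omega> x * f x) - ?Tq x"
  have "(\<integral>x. \<alpha> * (indicator \<Omega> x * (f x * ln (f x / h x))) \<partial>lborel) \<le> (\<integral>x. ?R x \<partial>lborel)"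
  proof (rule integral_mono)
    show "integrable lborel (\<lambda>x. \<alpha> * (indicator \<Omega> x * (f x * ln (f x / h x))))" using KLi by simp
    show "integrable lborel ?R" using J_int f_integrable Tq by auto
    fix x
    show "\<alpha> * (indicator \<Omega> x * (f x * ln (f x / h x))) \<le> ?R x"
    proof (cases "x \<in> \<Omega>")
      case True
      have fx: "f x > 0" and Vx: "V x > 0" and gx: "g (T x) > 0" using f_pos V_pos g_pos True by auto
      \<comment> \<open>The logarithmic bound with multiplier \<open>s = 1 / B\<close>: as
        \<open>f / g (T) = T'\<close>, the mean of \<open>V / g (T)\<close> under \<open>f\<close>
        is the integral of \<open>J\<close>, which is at most \<open>B\<close>.\<close>
      have "ln (V x / g (T x) / B) \<le> V x / g (T x) / B - 1"
        using fx Vx gx B by (intro ln_le_minus_one) auto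
      moreover have "ln (V x / g (T x) / B) = ln (V x) - ln (g (T x)) - ln B"
        using Vx gx B by (simp add: ln_div ln_mult)
      moreover have "ln (g (T x)) = - (\<bar>T x\<bar> powr q) - ln ?Z" using Z by (simp add: g_def ln_div)
      moreover have "ln (V x) = \<alpha> * ln (f x / h x)"
        using fx h_pos[OF True] by (simp add: V_def ln_powr)
      ultimately have "\<alpha> * ln (f x / h x) \<le> V x / g (T x) / B - 1 + ln B - ln ?Z - \<bar>T x\<bar> powr q" by simp
      then have "f x * (\<alpha> * ln (f x / h x)) \<le> f x * (V x / g (T x) / B - 1 + ln B - ln ?Z - \<bar>T x\<bar> powr q)"
        using fx by (intro mult_left_mono) auto
      also have "\<dots> = T' x * V x / B + (ln B - 1 - ln ?Z) * f x - f x * \<bar>T x\<bar> powr q"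
        by (simp add: T'_def algebra_simps)
      finally show ?thesis using True by (simp add: J_def mult.left_commute)
    qed (simp add: J_def)
  qed
  also have "\<dots> = (\<integral>x. J x \<partial>lborel) / B + (ln B - 1 - ln ?Z) - 1 / q"
    using J_int f_integrable f_integral Tq by simp
  also have "\<dots> \<le> ln B - ln ?Z - 1 / q" using J_B B by (simp add: field_simps)
  finally have "\<alpha> * rel_ent \<le> ln B - ln ?Z - 1 / q" by (simp add: rel_ent_def)
  then have "exp (ln ?Z + 1 / q) \<le> exp (ln B - \<alpha> * rel_ent)" by simp
  then have "?Z * exp (1 / q) \<le> B * exp (- (\<alpha> * rel_ent))"
    using Z B by (simp add: exp_add exp_diff exp_minus divide_inverse)
  \<comment> \<open>Dividing by \<open>\<sigma>\<close> leaves \<open>\<Phi>\<close> on the right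
    and completes the left side to \<open>gg_bound q\<close>.\<close>
  then have "(?Z * exp (1 / q)) / \<sigma> \<le> (B * exp (- (\<alpha> * rel_ent))) / \<sigma>" using \<sigma> by (intro divide_right_mono) auto
  moreover have "(?Z * exp (1 / q)) / \<sigma> = gg_bound q"
    using q0 by (simp add: \<sigma>_def gg_bound_def powr_divide powr_mult powr_def[of "exp 1"])
  ultimately show ?thesis using \<sigma> by (simp add: B_def \<Phi>_def)
qed

text \<open>What remains is to recognize the integrand of \<open>rel_fisher\<close>, treat an
  infinite Fisher integral, where the real divergence gives a positive factor, and take the power
  \<open>1 / \<alpha>\<close>.\<close>

lemma (in escort_pair) fisher_entropy:
  fixes p q :: real
  assumes p: "p > 1" and q_def: "q = p / (p - 1)"
  shows "exp_ereal (- KL_div xi xf f h) * rel_fisher p \<alpha> xi xf f h \<ge> ennreal ((gg_bound q / \<alpha>) powr (1 / \<alpha>))"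
proof -
  define I where "I = (\<integral>\<^sup>+x\<in>\<Omega>. ennreal (f x * (\<bar>V' x\<bar> / (\<alpha> * f x)) powr p) \<partial>lborel)"
  have q0: "q > 0" using p by (simp add: q_def)
  have pa: "1 / (p * \<alpha>) > 0" using p \<alpha>_pos by simp
  have fisher: "rel_fisher p \<alpha> xi xf f h = epowr I (1 / (p * \<alpha>))"
  proof -
    have "f x powr (1 + p * (\<alpha> - 1)) * h x powr (- \<alpha> * p) * \<bar>deriv (\<lambda>t. ln (f t / h t)) x\<bar> powr p
      = f x * (\<bar>V' x\<bar> / (\<alpha> * f x)) powr p" if x: "x \<in> \<Omega>" for x
    proof -
      have fx: "f x > 0" and hx: "h x > 0" using f_pos h_pos x by auto
      \<comment> \<open>The factor \<open>\<alpha>\<close> in \<open>V'\<close> cancels and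
        \<open>V / f = f^(\<alpha> - 1) h^(-\<alpha>)\<close>.\<close>
      have "\<bar>V' x\<bar> / (\<alpha> * f x) = (f x powr (\<alpha> - 1) * h x powr (- \<alpha>)) * \<bar>deriv (\<lambda>t. ln (f t / h t)) x\<bar>"
        using fx hx \<alpha>_pos V_pos[OF x]
        by (simp add: V'_def V_def abs_mult powr_divide powr_diff powr_minus field_simps)
      then have "(\<bar>V' x\<bar> / (\<alpha> * f x)) powr p
        = f x powr (p * (\<alpha> - 1)) * h x powr (- \<alpha> * p) * \<bar>deriv (\<lambda>t. ln (f t / h t)) x\<bar> powr p"
        by (simp add: powr_mult powr_powr mult.commute)
      then show ?thesis using fx by (simp add: powr_add)
    qed
    then show ?thesis
      unfolding rel_fisher_def I_def \<Omega>_def[symmetric]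
      by (intro arg_cong2[of _ _ _ _ epowr] nn_integral_cong) (auto simp: indicator_def)
  qed
  note KL = KL_real[OF KL_finite]
  show ?thesis
  proof (cases "I = \<infinity>")
    case True
    then show ?thesis using pa p \<alpha>_pos by (simp add: fisher epowr_def KL exp_ereal_def ennreal_mult_top ennreal_eq_0_iff)
  next
    case False
    then obtain r where r: "I = ennreal r" "r \<ge> 0" by (cases I rule: ennreal_cases) auto
    have le: "gg_bound q \<le> \<alpha> * r powr (1 / p) * exp (- (\<alpha> * rel_ent))"
      using fisher_entropy_finite[OF p q_def] r unfolding I_def by blast
    then have r0: "r > 0" using gg_bound_pos[OF q0] r(2) p by (cases "r = 0") auto
    have "gg_bound q / \<alpha> \<le> r powr (1 / p) * exp (- (\<alpha> * rel_ent))"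
      using le \<alpha>_pos by (simp add: field_simps)
    then have "(gg_bound q / \<alpha>) powr (1 / \<alpha>) \<le> (r powr (1 / p) * exp (- (\<alpha> * rel_ent))) powr (1 / \<alpha>)"
      using gg_bound_pos[OF q0] \<alpha>_pos by (intro powr_mono2) auto
    also have "\<dots> = exp (- rel_ent) * r powr (1 / (p * \<alpha>))"
      using r0 \<alpha>_pos by (simp add: powr_mult powr_powr powr_def[of "exp _"])
    finally show ?thesis
      using r r0 pa p \<alpha>_pos
      by (simp add: fisher epowr_def KL exp_ereal_def ennreal_leI flip: ennreal_mult'')
  qed
qed

section \<open>From the support hypotheses to the interval, and the two claims\<close>

lemma fun_support_einterval:
  assumes "fun_support f = closure (einterval xi xf)"
  shows "AE x in lborel. x \<notin> einterval xi xf \<longrightarrow> f x = 0"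
proof -
  let ?C = "{real_of_ereal xi, real_of_ereal xf}"
  have "AE x in lborel. x \<notin> ?C"
    by (intro AE_not_in finite_imp_null_set_lborel) auto
  then show ?thesis
  proof eventually_elim
    case (elim x)
    show ?case
    proof (intro impI, rule ccontr)
      assume x: "x \<notin> einterval xi xf" and "f x \<noteq> 0"
      then have "x \<in> fun_support f"
        using closure_subset[of "{x. f x \<noteq> 0}"] by (auto simp: fun_support_def)
      then have "x \<in> closure (einterval xi xf)" using assms by simp
      also have "closure (einterval xi xf) \<subseteq> {x. xi \<le> ereal x \<and> ereal x \<le> xf}"
      proof (rule closure_minimal)
        show "closed {x. xi \<le> ereal x \<and> ereal x \<le> xf}"
          by (intro closed_Collect_conj closed_Collect_le continuous_intros)
      qed (auto simp: einterval_iff)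
      finally have "xi = ereal x \<or> xf = ereal x" using x by (auto simp: einterval_iff)
      then show False using elim by auto
    qed
  qed
qed

lemma density_pairI:
  assumes "xi < xf" "is_pdf f" "is_pdf h"
    and "fun_support f = closure (einterval xi xf)" "fun_support h = closure (einterval xi xf)"
    and "\<forall>x\<in>einterval xi xf. f x > 0 \<and> h x > 0" "\<alpha> > 0"
  shows "density_pair f h xi xf \<alpha>"
proof -
  have *: "(\<integral>\<^sup>+x\<in>einterval xi xf. ennreal (g x) \<partial>lborel) = 1"
    if "is_pdf g" "fun_support g = closure (einterval xi xf)" for g
  proof -
    have "(\<integral>\<^sup>+x\<in>einterval xi xf. ennreal (g x) \<partial>lborel) = (\<integral>\<^sup>+x. ennreal (g x) \<partial>lborel)"
      using fun_support_einterval[OF that(2)]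
      by (intro nn_integral_cong_AE, eventually_elim) (auto simp: indicator_def)
    then show ?thesis using that by (simp add: is_pdf_def)
  qed
  show ?thesis
    using assms *[of f] *[of h] by unfold_locales (auto simp: is_pdf_def)
qed

theorem theorem4p2:
  fixes f h :: "real \<Rightarrow> real" and xi xf :: ereal and p \<alpha> :: real
  assumes "xi < xf"
    and "is_pdf f" and "is_pdf h"
    and "fun_support f = closure (einterval xi xf)"
    and "fun_support h = closure (einterval xi xf)"
    and "\<forall>x\<in>einterval xi xf. f x > 0 \<and> h x > 0"
    and "\<alpha> > 0"
  shows "(holder_conj p > 0 \<longrightarrow>
            rel_sigma (holder_conj p) \<alpha> xi xf f h * exp_ereal (KL_div xi xf f h)
              \<ge> ennreal (K0 p powr (1 / \<alpha>)))
       \<and> (p > 1 \<and> f differentiable_on einterval xi xf \<and> h differentiable_on einterval xi xf \<longrightarrow>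
            (\<forall>y. escort_variable \<alpha> xi xf f h y \<and> abs_continuous_real (rel_escort \<alpha> xi xf f h y) \<longrightarrow>
              exp_ereal (- KL_div xi xf f h) * rel_fisher p \<alpha> xi xf f h
                \<ge> ennreal ((K1 p / \<alpha>) powr (1 / \<alpha>))))"
proof (intro conjI impI allI)
  interpret density_pair f h xi xf \<alpha> "einterval xi xf"
    using assms by (rule density_pairI)
  {
    assume q: "holder_conj p > 0"
    show "rel_sigma (holder_conj p) \<alpha> xi xf f h * exp_ereal (KL_div xi xf f h) \<ge> ennreal (K0 p powr (1 / \<alpha>))"
      using moment_entropy[OF q] K0_eq[OF refl q] by simp
  next
    fix y
    assume A: "p > 1 \<and> f differentiable_on einterval xi xf \<and> h differentiable_on einterval xi xf"
      and y: "escort_variable \<alpha> xi xf f h y \<and> abs_continuous_real (rel_escort \<alpha> xi xf f h y)"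
    interpret escort_pair f h xi xf \<alpha> "einterval xi xf" y
      using A y by unfold_locales (auto simp: differentiable_on_eq_differentiable_at)
    show "exp_ereal (- KL_div xi xf f h) * rel_fisher p \<alpha> xi xf f h \<ge> ennreal ((K1 p / \<alpha>) powr (1 / \<alpha>))"
      using fisher_entropy[of p "holder_conj p"] A K1_eq[OF refl, of p] by (simp add: holder_conj_def)
  }
qed

end
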